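(* Let $q$ be a prime power and let $\alpha\in\mathbb{F}_{q^6}$ with $\mathrm{N}_{q^6/q^3}(\alpha)\ne0,1$. The $\mathbb{F}_q$-linear set \[ L_{f_3}=\{\langle(x,x^{q^5}+\alpha x^{q^2})\rangle_{\mathbb{F}_{q^6}}\colon x\in\mathbb{F}_{q^6}^*\} \] of $\mathrm{PG}(1,q^6)$ is scattered if and only if the equation \[ Y^2-(\mathrm{Tr}_{q^3/q}(A)-1)Y+\mathrm{N}_{q^3/q}(A)=0,\qquad A=\frac{-\alpha^{q^3+1}}{1-\alpha^{q^3+1}}, \] admits two (distinct) roots in $\mathbb{F}_q$. In particular, for any $q>2$ there always exists such an $\alpha$ (that is, an $\alpha\in\mathbb{F}_{q^6}$ with $\mathrm{N}_{q^6/q^3}(\alpha)\ne0,1$ for which $L_{f_3}$ is scattered).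
   Context: $\mathrm{N}_{q^6/q^3}(\alpha)=\alpha^{q^3+1}$; $\mathrm{Tr}_{q^3/q}$ and $\mathrm{N}_{q^3/q}$ are the trace and norm from $\mathbb{F}_{q^3}$ to $\mathbb{F}_q$ (note $A\in\mathbb{F}_{q^3}$). With $U=\{(x,x^{q^5}+\alpha x^{q^2})\colon x\in\mathbb{F}_{q^6}\}$, the weight of a point $\langle\mathbf{u}\rangle_{\mathbb{F}_{q^6}}$ is $\dim_{\mathbb{F}_q}(U\cap\langle\mathbf{u}\rangle_{\mathbb{F}_{q^6}})$. $L_{f_3}$ is called scattered if all of its points have weight one, equivalently $|L_{f_3}|=(q^6-1)/(q-1)$. *)

theory Defs
  imports "HOL-Number_Theory.Number_Theory" "HOL-Library.Product_Plus" "HOL-Library.Cardinality"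
begin

(* Inside a finite field whose order is a power of r, this is its unique subfield of order r. *)
definition subfld :: "nat \<Rightarrow> 'a::field set" where
  "subfld r = {x. x ^ r = x}"

definition rel_trace :: "nat \<Rightarrow> nat \<Rightarrow> 'a::field \<Rightarrow> 'a" where  (* F_{r^n} to F_r *)
  "rel_trace r n x = (\<Sum>i<n. x ^ (r ^ i))"

definition rel_norm :: "nat \<Rightarrow> nat \<Rightarrow> 'a::field \<Rightarrow> 'a" where  (* F_{r^n} to F_r *)
  "rel_norm r n x = (\<Prod>i<n. x ^ (r ^ i))"

lemma rel_norm_2: "rel_norm r 2 x = x ^ (r + 1)"
  by (simp add: rel_norm_def numeral_2_eq_2)

definition vscale :: "'a::field \<Rightarrow> 'a \<times> 'a \<Rightarrow> 'a \<times> 'a" where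
  "vscale c u = (c * fst u, c * snd u)"

(* For u \<noteq> 0 this is the point of PG(1,F) spanned by u, as a one-dimensional F-subspace. *)
definition proj_point :: "'a::field \<times> 'a \<Rightarrow> ('a \<times> 'a) set" where
  "proj_point u = range (\<lambda>c. vscale c u)"

definition span_over :: "'a::field set \<Rightarrow> ('a \<times> 'a) set \<Rightarrow> ('a \<times> 'a) set" where
  "span_over K B = {(\<Sum>b\<in>B. vscale (c b) b) | c. \<forall>b\<in>B. c b \<in> K}"

definition indep_over :: "'a::field set \<Rightarrow> ('a \<times> 'a) set \<Rightarrow> bool" where
  "indep_over K B \<longleftrightarrow>
     (\<forall>c. (\<forall>b\<in>B. c b \<in> K) \<and> (\<Sum>b\<in>B. vscale (c b) b) = 0 \<longrightarrow> (\<forall>b\<in>B. c b = 0))"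

(* The scalars range over a subfield K given as a set rather than as a type, so the library's
   dim does not apply. Only meaningful for finite-dimensional K-subspaces V. *)
definition dim_over :: "'a::field set \<Rightarrow> ('a \<times> 'a) set \<Rightarrow> nat" where
  "dim_over K V = (THE n. \<exists>B. finite B \<and> indep_over K B \<and> span_over K B = V \<and> card B = n)"

definition weight :: "nat \<Rightarrow> ('a::field \<times> 'a) set \<Rightarrow> ('a \<times> 'a) set \<Rightarrow> nat" where
  "weight q U P = dim_over (subfld q) (U \<inter> P)"

(* The linear set defined by U; U is meant to be an F_q-subspace of F^2. *)
definition linear_set :: "('a::field \<times> 'a) set \<Rightarrow> ('a \<times> 'a) set set" where
  "linear_set U = proj_point ` (U - {0})"

definition scattered :: "nat \<Rightarrow> ('a::field \<times> 'a) set \<Rightarrow> bool" where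
  "scattered q U \<longleftrightarrow> (\<forall>P\<in>linear_set U. weight q U P = 1)"

definition U_f3 :: "nat \<Rightarrow> 'a::field \<Rightarrow> ('a \<times> 'a) set" where
  "U_f3 q \<alpha> = range (\<lambda>x. (x, x ^ (q ^ 5) + \<alpha> * x ^ (q ^ 2)))"

lemma linear_set_U_f3:
  assumes "q > 0"
  shows "linear_set (U_f3 q \<alpha>) =
    {proj_point (x, x ^ (q ^ 5) + \<alpha> * x ^ (q ^ 2)) | x. x \<noteq> 0}"
proof -
  define f where "f = (\<lambda>x. (x, x ^ (q ^ 5) + \<alpha> * x ^ (q ^ 2)))"
  have "f x = 0 \<longleftrightarrow> x = 0" for x
    using assms by (cases "x = 0") (simp_all add: f_def zero_prod_def power_0_left)
  then have "linear_set (range f) = {proj_point (f x) | x. x \<noteq> 0}"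
    unfolding linear_set_def by blast
  then show ?thesis by (simp only: f_def U_f3_def)
qed

end

(* Write f x = x ^ (q ^ 5) + \<alpha> * x ^ (q ^ 2) and l_i = l ^ (q ^ i). Eliminating x from
   f (l x) = l f x shows that L is not scattered only if A is the cross-ratio
   - (l_0 - l_5) (l_3 - l_2) / ((l_3 - l_0) (l_5 - l_2)) for some l outside F_q. With
   d_i = l_{i+3} - l_i and m_i = l_{i+1} - l_i, the element Y = - m_0 m_2 m_4 / (d_0 d_1 d_2)
   then satisfies Y + Y ^ q = Tr A - 1 and Y ^ (q + 1) = N A, so Y and Y ^ q are the roots of the
   quadratic, which therefore does not have two distinct roots in F_q. Conversely, if it does not,
   its roots are Y and Y ^ q for some Y. From Y, Hilbert 90 and the surjectivity of the norm one
   gets b such that f x = - b ^ (q ^ 5) * x has a two-dimensional solution space, by Galois descent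
   from F_{q^3} to F_q. *)
theory Submission
  imports Defs "HOL-Algebra.Algebraic_Closure_Type"
begin

subsection \<open>Dimension over a subfield given as a set\<close>

text \<open>Linear algebra is replaced by counting: a K-space of dimension n has |K|^n elements, and
  facts about the subfields and norms of a field with q^6 elements come from bounding numbers of
  roots. The semilinear map of the converse comes from elimination. Applying the powers q and q^4 to
  \<open>f x = - b ^ (q ^ 5) * x\<close> gives two equations linear in x and x_3; solving for x
  gives x = \<open>\<phi> x\<close>, with \<open>\<phi>\<close> semilinear over F_{q^3}. Descent
  needs \<open>\<phi>\<close> to have order three, which two equations on b ensure. Their quotient
  involves b only through b_3 / b and its conjugates, and a root Y supplies a suitable ratio; the
  remaining scalar from F_{q^3} is fixed by its norm. Existence for q > 2 is a search for A: since N
  -> N / (N - 1) is an involution and the norm to F_{q^3} is onto, every A in F_{q^3} other than 0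
  and 1 occurs. Inside F_q, A = w (1 - w) gives the roots -w^3 and -(1 - w)^3. For q = 3 and q = 4
  no w in F_q is suitable, so A is taken of degree three over the prime field.\<close>

lemma vscale_add_right: "vscale c (u + v) = vscale c u + vscale c v"
  by (simp add: vscale_def prod_eq_iff algebra_simps)

lemma vscale_diff_left: "vscale (c - d) u = vscale c u - vscale d u"
  by (simp add: vscale_def prod_eq_iff algebra_simps)

lemma vscale_vscale: "vscale c (vscale d u) = vscale (c * d) u"
  by (simp add: vscale_def)

lemma vscale_zero [simp]: "vscale 0 u = 0" "vscale c 0 = 0"
  by (simp_all add: vscale_def zero_prod_def)

lemma vscale_one [simp]: "vscale 1 u = u"
  by (simp add: vscale_def)

lemma vscale_sum: "vscale c (\<Sum>b\<in>B. g b) = (\<Sum>b\<in>B. vscale c (g b))"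
  by (induction B rule: infinite_finite_induct) (simp_all add: vscale_add_right)

text \<open>Closure under \<open>x / y\<close> includes y = 0, which is harmless because
  \<open>x / 0 = 0\<close>.\<close>

definition subfield_set :: "'a::field set \<Rightarrow> bool" where
  "subfield_set K \<longleftrightarrow>
     0 \<in> K \<and> 1 \<in> K \<and> (\<forall>x\<in>K. \<forall>y\<in>K. x - y \<in> K \<and> x * y \<in> K \<and> x / y \<in> K)"

definition subspace_over :: "'a::field set \<Rightarrow> ('a \<times> 'a) set \<Rightarrow> bool" where
  "subspace_over K V \<longleftrightarrow>
     0 \<in> V \<and> (\<forall>u\<in>V. \<forall>v\<in>V. u + v \<in> V) \<and> (\<forall>c\<in>K. \<forall>v\<in>V. vscale c v \<in> V)"

text \<open>Independence makes the map from coefficient functions on B to their combinations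
  injective, so the span is counted by those functions.\<close>

lemma card_span_over:
  assumes K: "subfield_set K" and B: "finite B" "indep_over K B"
  shows "card (span_over K B) = card K ^ card B"
proof -
  let ?h = "\<lambda>c. \<Sum>b\<in>B. vscale (c b) b"
  have inj: "inj_on ?h (B \<rightarrow>\<^sub>E K)"
  proof (rule inj_onI)
    fix c d assume c: "c \<in> B \<rightarrow>\<^sub>E K" and d: "d \<in> B \<rightarrow>\<^sub>E K" and eq: "?h c = ?h d"
    have "(\<Sum>b\<in>B. vscale (c b - d b) b) = 0"
      using eq by (simp add: vscale_diff_left sum_subtractf)
    moreover have "\<forall>b\<in>B. c b - d b \<in> K"
      using K c d by (auto simp: subfield_set_def PiE_iff)
    ultimately have "\<forall>b\<in>B. c b - d b = 0"
      using B(2) unfolding indep_over_def by (elim allE[where x = "\<lambda>b. c b - d b"]) blast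
    then show "c = d"
      using c d by (intro PiE_ext[of c B "\<lambda>_. K" d]) auto
  qed
  have "span_over K B = ?h ` (B \<rightarrow>\<^sub>E K)"
  proof
    show "span_over K B \<subseteq> ?h ` (B \<rightarrow>\<^sub>E K)"
    proof
      fix v assume "v \<in> span_over K B"
      then obtain c where c: "v = ?h c" "\<forall>b\<in>B. c b \<in> K"
        by (auto simp: span_over_def)
      have "v = ?h (restrict c B)"
        unfolding c(1) by (rule sum.cong) auto
      moreover have "restrict c B \<in> B \<rightarrow>\<^sub>E K"
        using c(2) by auto
      ultimately show "v \<in> ?h ` (B \<rightarrow>\<^sub>E K)"
        by blast
    qed
    show "?h ` (B \<rightarrow>\<^sub>E K) \<subseteq> span_over K B"
      unfolding span_over_def by (auto simp: PiE_iff intro!: exI)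
  qed
  then show ?thesis
    using B(1) by (simp add: card_image[OF inj] card_funcsetE)
qed

lemma span_over_subset:
  assumes V: "subspace_over K V" and B: "B \<subseteq> V"
  shows "span_over K B \<subseteq> V"
proof -
  have "(\<Sum>b\<in>C. vscale (c b) b) \<in> V" if "\<forall>b\<in>C. c b \<in> K" "C \<subseteq> V" for c C
    using that V by (induction C rule: infinite_finite_induct) (auto simp: subspace_over_def)
  then show ?thesis
    using B by (auto simp: span_over_def)
qed

lemma subset_span_over:
  assumes "subfield_set K" "finite B"
  shows "B \<subseteq> span_over K B"
proof
  fix v assume v: "v \<in> B"
  have "(\<Sum>b\<in>B. vscale (if b = v then 1 else 0) b) = (\<Sum>b\<in>B. if b = v then v else 0)"
    by (rule sum.cong) auto
  also have "\<dots> = v"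
    using v assms(2) by simp
  finally have "v = (\<Sum>b\<in>B. vscale ((if b = v then 1 else 0)) b)" ..
  moreover have "\<forall>b\<in>B. (if b = v then 1 else 0) \<in> K"
    using assms(1) by (simp add: subfield_set_def)
  ultimately show "v \<in> span_over K B"
    unfolding span_over_def by (intro CollectI exI[where x = "\<lambda>b. if b = v then 1 else 0"]) simp
qed

lemma indep_over_insert:
  assumes K: "subfield_set K" and B: "finite B" "indep_over K B" and v: "v \<notin> span_over K B"
  shows "indep_over K (insert v B)"
  unfolding indep_over_def
proof (intro allI impI)
  fix c assume c: "(\<forall>b\<in>insert v B. c b \<in> K) \<and> (\<Sum>b\<in>insert v B. vscale (c b) b) = 0"
  have vB: "v \<notin> B"
    using subset_span_over[OF K B(1)] v by blast
  have eq: "vscale (c v) v + (\<Sum>b\<in>B. vscale (c b) b) = 0"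
    using c B(1) vB by simp
  have "c v = 0"
  proof (rule ccontr)
    assume ne: "c v \<noteq> 0"
    have "vscale (c v) v = - (\<Sum>b\<in>B. vscale (c b) b)"
      using eq by (simp add: eq_neg_iff_add_eq_0)
    also have "\<dots> = vscale (- 1) (\<Sum>b\<in>B. vscale (c b) b)"
      by (simp add: vscale_def prod_eq_iff)
    finally have "vscale (1 / c v) (vscale (c v) v)
        = vscale (1 / c v) (vscale (- 1) (\<Sum>b\<in>B. vscale (c b) b))"
      by simp
    then have "v = (\<Sum>b\<in>B. vscale ((0 - c b) / c v) b)"
      using ne by (simp add: vscale_vscale vscale_sum)
    moreover have "\<forall>b\<in>B. (0 - c b) / c v \<in> K"
      using K c by (simp only: subfield_set_def) blast
    ultimately have "v \<in> span_over K B"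
      unfolding span_over_def by (intro CollectI exI[where x = "\<lambda>b. (0 - c b) / c v"]) simp
    with v show False ..
  qed
  with eq have "(\<Sum>b\<in>B. vscale (c b) b) = 0"
    by simp
  with c B(2) have "\<forall>b\<in>B. c b = 0"
    unfolding indep_over_def by simp
  with \<open>c v = 0\<close> show "\<forall>b\<in>insert v B. c b = 0"
    by simp
qed

text \<open>An independent subset of V that is maximal under inclusion spans V, since any vector
  outside its span could be inserted.\<close>

lemma basis_over_exists:
  assumes K: "subfield_set K" and V: "subspace_over K V" "finite V"
  shows "\<exists>B. finite B \<and> indep_over K B \<and> span_over K B = V"
proof -
  let ?I = "{B. B \<subseteq> V \<and> indep_over K B}"
  have "finite ?I"
    using V(2) by simp
  moreover have "{} \<in> ?I"
    by (simp add: indep_over_def)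
  then have "?I \<noteq> {}"
    by (rule ex_in_conv[THEN iffD1, OF exI])
  ultimately have "\<exists>B\<in>?I. \<forall>C\<in>?I. B \<le> C \<longrightarrow> B = C"
    by (rule finite_has_maximal)
  then obtain B where B: "B \<in> ?I" and max: "\<And>C. C \<in> ?I \<Longrightarrow> B \<subseteq> C \<Longrightarrow> B = C"
    by (elim bexE) simp
  have fin: "finite B"
    using B V(2) finite_subset by blast
  have "v \<in> span_over K B" if "v \<in> V" for v
  proof (rule ccontr)
    assume v: "v \<notin> span_over K B"
    then have "insert v B \<in> ?I"
      using B that indep_over_insert[OF K fin _ v] by auto
    with max have "v \<in> B"
      by blast
    with v subset_span_over[OF K fin] show False
      by blast
  qed
  with B fin span_over_subset[OF V(1)] show ?thesis
    by blast
qed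

text \<open>All bases have the same size because |V| = |K|^|B| and |K| > 1. This makes the definite
  description in \<open>dim_over\<close> meaningful and turns weights into cardinalities.\<close>

lemma dim_over_eq_1_iff:
  assumes K: "subfield_set K" "finite K" and V: "subspace_over K V" "finite V"
  shows "dim_over K V = 1 \<longleftrightarrow> card V = card K"
proof -
  have "{0, 1} \<subseteq> K"
    using K(1) by (simp add: subfield_set_def)
  then have "card {0, 1 :: 'a} \<le> card K"
    using K(2) by (rule card_mono[rotated])
  then have gt: "1 < card K"
    by simp
  obtain B where B: "finite B" "indep_over K B" "span_over K B = V"
    using basis_over_exists[OF K(1) V] by blast
  have uniq: "card C = card B" if "finite C" "indep_over K C" "span_over K C = V" for C
    using card_span_over[OF K(1) B(1,2)] card_span_over[OF K(1) that(1,2)] B(3) that(3)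
      power_inject_exp[OF gt] by metis
  have "dim_over K V = card B"
    unfolding dim_over_def
  proof (rule the_equality)
    show "\<exists>C. finite C \<and> indep_over K C \<and> span_over K C = V \<and> card C = card B"
      using B by (intro exI[of _ B]) simp
  qed (elim exE conjE, metis uniq)
  moreover have "card V = card K ^ card B"
    using card_span_over[OF K(1) B(1,2)] B(3) by simp
  ultimately show ?thesis
    using power_inject_exp[OF gt, of "card B" 1] by simp
qed

subsection \<open>Finite fields\<close>

lemma card_power_eq_le:
  fixes c :: "'a::idom"
  assumes "n > 0"
  shows "card {x. x ^ n = c} \<le> n"
proof -
  let ?p = "monom 1 n - [:c:]"
  have deg: "degree ?p = n"
    using assms by (simp add: degree_monom_eq flip: add_uminus_conv_diff add: degree_add_eq_left)
  then have "?p \<noteq> 0"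
    using assms by auto
  from card_poly_roots_bound[OF this] show ?thesis
    by (simp add: deg poly_monom)
qed

lemma power_card_minus_1:
  fixes x :: "'a::{field,finite}"
  assumes "x \<noteq> 0"
  shows "x ^ (CARD('a) - 1) = 1"
proof -
  have bij: "bij_betw ((*) x) (UNIV - {0}) (UNIV - {0})"
    using assms by (intro bij_betwI[where g = "\<lambda>y. y / x"]) auto
  have "(\<Prod>y\<in>UNIV - {0}. x * y) = \<Prod>(UNIV - {0})"
    using prod.reindex_bij_betw[OF bij, of "\<lambda>y. y"] by simp
  then show ?thesis
    by (simp add: prod.distrib card_Diff_singleton)
qed

lemma power_card_eq_self:
  fixes x :: "'a::{field,finite}"
  shows "x ^ CARD('a) = x"
proof (cases "x = 0")
  case False
  have "x ^ CARD('a) = x * x ^ (CARD('a) - 1)"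
    by (metis finite_UNIV_card_ge_0 finite power_eq_if neq0_conv)
  with power_card_minus_1[OF False] show ?thesis
    by simp
qed simp

text \<open>Every fibre of \<open>x \<mapsto> x ^ d\<close> has at most \<open>d\<close> elements, so its image on the units has at least
  \<open>k\<close> elements and exhausts the at most \<open>k\<close> solutions of \<open>y ^ k = 1\<close>.\<close>
lemma power_image_units:
  assumes "d * k = CARD('a::{field,finite}) - 1"
  shows "(\<lambda>x::'a. x ^ d) ` (UNIV - {0}) = {y. y ^ k = 1}" and "card {y::'a. y ^ k = 1} = k"
proof -
  have "card {0, 1 :: 'a} \<le> CARD('a)"
    by (rule card_mono) auto
  then have "d * k > 0"
    unfolding assms by simp
  then have pos: "d > 0" "k > 0"
    by auto
  let ?I = "(\<lambda>x::'a. x ^ d) ` (UNIV - {0})"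
  have sub: "?I \<subseteq> {y. y ^ k = 1}"
    using power_card_minus_1[where 'a = 'a] assms by (auto simp flip: power_mult)
  have "UNIV - {0 :: 'a} = (\<Union>y\<in>?I. {x\<in>UNIV - {0}. x ^ d = y})"
    by auto
  then have "d * k = card (\<Union>y\<in>?I. {x\<in>UNIV - {0 :: 'a}. x ^ d = y})"
    using assms by (metis card_Diff_singleton UNIV_I)
  also have "\<dots> \<le> (\<Sum>y\<in>?I. card {x\<in>UNIV - {0 :: 'a}. x ^ d = y})"
    by (rule card_UN_le) simp
  also have "\<dots> \<le> (\<Sum>y\<in>?I. d)"
  proof (rule sum_mono)
    fix y :: 'a
    have "card {x\<in>UNIV - {0 :: 'a}. x ^ d = y} \<le> card {x. x ^ d = y}"
      by (rule card_mono) auto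
    also have "\<dots> \<le> d"
      by (rule card_power_eq_le[OF pos(1)])
    finally show "card {x\<in>UNIV - {0 :: 'a}. x ^ d = y} \<le> d" .
  qed
  finally have "k \<le> card ?I"
    using pos by simp
  moreover have "card ?I \<le> card {y :: 'a. y ^ k = 1}"
    using sub by (rule card_mono[rotated]) simp
  moreover have "card {y :: 'a. y ^ k = 1} \<le> k"
    by (rule card_power_eq_le[OF pos(2)])
  ultimately have "card ?I = card {y :: 'a. y ^ k = 1}" and k: "card {y::'a. y ^ k = 1} = k"
    by simp_all
  with sub show "?I = {y. y ^ k = 1}"
    by (intro card_subset_eq) simp_all
  show "card {y::'a. y ^ k = 1} = k"
    by (rule k)
qed

text \<open>Stands in for cyclicity of the unit group: every solvability statement below is a
  factorization of q^6 - 1.\<close>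

lemma power_root_exists:
  fixes y :: "'a::{field,finite}"
  assumes "d * k = CARD('a) - 1" "y ^ k = 1"
  shows "\<exists>x. x \<noteq> 0 \<and> x ^ d = y"
proof -
  have "y \<in> (\<lambda>x. x ^ d) ` (UNIV - {0})"
    using assms(2) unfolding power_image_units(1)[OF assms(1)] by simp
  then show ?thesis
    by auto
qed

text \<open>The base field provides all \<open>CARD('a)\<close> roots of \<open>X ^ CARD('a) - X\<close> in its algebraic closure.\<close>
lemma alg_closure_fixed_in_range:
  fixes z :: "'a::{field,finite} alg_closure"
  assumes z: "z ^ CARD('a) = z"
  shows "z \<in> range to_ac"
proof -
  have two: "1 < CARD('a)"
    using card_mono[of UNIV "{0, 1 :: 'a}"] by simp
  let ?p = "monom 1 CARD('a) - monom 1 1 :: 'a alg_closure poly"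
  have deg: "degree ?p = CARD('a)"
    using two by (simp add: degree_monom_eq flip: add_uminus_conv_diff add: degree_add_eq_left)
  then have ne: "?p \<noteq> 0"
    using two by auto
  have fin: "finite {z. poly ?p z = 0}"
    by (rule poly_roots_finite[OF ne])
  have "range (to_ac :: 'a \<Rightarrow> _) \<subseteq> {z. poly ?p z = 0}"
    by (auto simp: poly_monom power_card_eq_self simp flip: to_ac_power)
  moreover have "card {z. poly ?p z = 0} \<le> card (range (to_ac :: 'a \<Rightarrow> _))"
    using card_poly_roots_bound[OF ne] deg by (simp add: card_image[OF inj_to_ac])
  ultimately have "range (to_ac :: 'a \<Rightarrow> _) = {z. poly ?p z = 0}"
    using fin by (meson card_seteq)
  with z show ?thesis
    by (auto simp: poly_monom)
qed

text \<open>A root is taken in the algebraic closure; the power map with exponent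
  \<open>CARD('a)\<close> fixes exactly the base field there, so a fixed root descends.\<close>

lemma poly_root_in_field:
  fixes p :: "'a::{field,finite} poly"
  assumes deg: "degree p > 0"
    and fixd: "\<And>z. poly (map_poly to_ac p) z = 0 \<Longrightarrow> z ^ CARD('a) = z"
  shows "\<exists>x. poly p x = 0"
proof -
  have "degree (map_poly to_ac p) = degree p"
    by (rule degree_map_poly) auto
  then obtain z where z: "poly (map_poly to_ac p) z = 0"
    using alg_closed_imp_poly_has_root[of "map_poly to_ac p"] deg by auto
  then obtain x where x: "z = to_ac x"
    using alg_closure_fixed_in_range[OF fixd[OF z]] by auto
  have "poly (map_poly to_ac p) (to_ac x) = to_ac (poly p x)"
    by (induction p) (auto simp: map_poly_pCons)
  with z x show ?thesis
    by (metis to_ac_eq_0_iff)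
qed

subsection \<open>Frobenius powers on a field with \<open>q ^ 6\<close> elements\<close>

locale sextic_field =
  fixes q :: nat and field_type :: "'a::{field,finite} itself"
  assumes primepow_q: "primepow q"
    and card_field: "CARD('a) = q ^ 6"
begin

definition frob :: "nat \<Rightarrow> 'a \<Rightarrow> 'a" where
  "frob i x = x ^ (q ^ i)"

lemma q_gt_1: "q > 1"
  using primepow_q by (rule primepow_gt_Suc_0[unfolded One_nat_def[symmetric]])

lemma prime_char: "Factorial_Ring.prime CHAR('a)"
  by (simp add: finite_imp_CHAR_pos prime_CHAR_semidom)

lemma q_char_power: "\<exists>n>0. q = CHAR('a) ^ n"
proof -
  obtain p n where p: "Factorial_Ring.prime p" "n > 0" "q = p ^ n"
    using primepow_q by (auto simp: primepow_def)
  have "CHAR('a) dvd p ^ (n * 6)"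
    using CHAR_dvd_CARD[where 'a = 'a] card_field p(3) by (simp add: power_mult)
  then have "CHAR('a) = p"
    using prime_char p(1) by (metis prime_dvd_power primes_dvd_imp_eq)
  with p show ?thesis
    by blast
qed

lemma frob_add: "frob i (x + y) = frob i x + frob i y"
proof -
  obtain n where "q = CHAR('a) ^ n"
    using q_char_power by blast
  then have "q ^ i = CHAR('a) ^ (n * i)"
    by (simp add: power_mult)
  then show ?thesis
    unfolding frob_def by (rule freshmans_dream'[OF prime_char])
qed

lemma frob_0 [simp]: "frob 0 x = x"
  by (simp add: frob_def)

lemma frob_zero [simp]: "frob i 0 = 0"
  using q_gt_1 by (simp add: frob_def)

lemma frob_one [simp]: "frob i 1 = 1"
  by (simp add: frob_def)

lemma frob_eq_0_iff [simp]: "frob i x = 0 \<longleftrightarrow> x = 0"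
  using q_gt_1 by (auto simp: frob_def)

lemma frob_mult: "frob i (x * y) = frob i x * frob i y"
  by (simp add: frob_def power_mult_distrib)

lemma frob_divide: "frob i (x / y) = frob i x / frob i y"
  by (simp add: frob_def power_divide)

lemma frob_minus: "frob i (- x) = - frob i x"
  using frob_add[of i x "- x"] by (simp add: eq_neg_iff_add_eq_0 add.commute)

lemma frob_diff: "frob i (x - y) = frob i x - frob i y"
  using frob_add[of i x "- y"] by (simp add: frob_minus)

lemma frob_6: "frob 6 x = x"
  unfolding frob_def using power_card_eq_self[of x] by (simp add: card_field)

lemma frob_fr_add: "frob i (frob j x) = frob (i + j) x"
  by (simp add: frob_def power_add mult.commute flip: power_mult)

lemma frob_mod: "frob n x = frob (n mod 6) x"
proof -
  have "frob (6 * m) y = y" for m y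
    by (induction m) (simp_all add: frob_6 flip: frob_fr_add)
  from this[of "n div 6" "frob (n mod 6) x"] show ?thesis
    by (simp add: frob_fr_add)
qed

lemma frob_fr: "frob i (frob j x) = frob ((i + j) mod 6) x"
  using frob_mod frob_fr_add by simp

lemma frob_Suc_Suc_0: "frob (Suc (Suc 0)) x = frob 2 x"
  by (simp add: numeral_2_eq_2)

lemmas frob_simps = frob_add frob_mult frob_divide frob_minus frob_diff frob_fr frob_Suc_Suc_0

lemma frob_inj: "frob i x = frob i y \<Longrightarrow> x = y"
  using frob_eq_0_iff[of i "x - y"] by (simp add: frob_diff)

lemma mem_subfld_iff: "x \<in> subfld (q ^ i) \<longleftrightarrow> frob i x = x"
  by (simp add: subfld_def frob_def)

lemma mem_subfld_q_iff: "x \<in> subfld q \<longleftrightarrow> frob 1 x = x"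
  using mem_subfld_iff[of x 1] by simp

lemma subfield_set_subfld: "subfield_set (subfld q :: 'a set)"
  by (simp add: subfield_set_def mem_subfld_q_iff frob_simps del: One_nat_def)

text \<open>As q^i - 1 divides q^6 - 1, the nonzero fixed points form the full group of (q^i - 1)-th
  roots of unity.\<close>

lemma card_subfld:
  assumes "i dvd 6"
  shows "card (subfld (q ^ i) :: 'a set) = q ^ i"
proof -
  have "(q ^ i - 1) dvd (q ^ 6 - 1)"
  proof -
    obtain m where m: "6 = i * m"
      using assms by (elim dvdE)
    have "int (q ^ i) - 1 dvd int (q ^ i) ^ m - 1"
      unfolding power_diff_1_eq by simp
    then have "int (q ^ i - 1) dvd int (q ^ 6 - 1)"
      using q_gt_1 by (simp add: of_nat_diff m power_mult)
    then show ?thesis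
      by (simp only: of_nat_dvd_iff)
  qed
  then obtain k where k: "k * (q ^ i - 1) = CARD('a) - 1"
    unfolding card_field by (metis dvd_def mult.commute)
  have i: "i > 0"
    using assms by (auto intro: Nat.gr0I)
  then have gt: "q ^ i > 1"
    using q_gt_1 by (intro one_less_power)
  have "x ^ (q ^ i) = x * x ^ (q ^ i - 1)" for x :: 'a
    using gt by (metis power_minus_mult mult.commute less_trans zero_less_one)
  then have "subfld (q ^ i) = insert 0 {x::'a. x ^ (q ^ i - 1) = 1}"
    using gt by (auto simp: subfld_def)
  moreover have "card {x::'a. x ^ (q ^ i - 1) = 1} = q ^ i - 1"
    by (rule power_image_units(2)[OF k])
  moreover have "0 < q ^ i - 1"
    using gt by linarith
  then have "0 \<notin> {x::'a. x ^ (q ^ i - 1) = 1}"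
    by (simp add: zero_power)
  ultimately show ?thesis
    using gt by simp
qed

lemma card_subfld_q: "card (subfld q :: 'a set) = q"
  using card_subfld[of 1] by simp

section \<open>Hilbert 90, surjectivity of norms, and nonvanishing of traces\<close>

lemma hilbert_90:
  assumes "c * frob 3 c = 1"
  shows "\<exists>b. b \<noteq> 0 \<and> frob 3 b = b * c"
proof -
  have "(q ^ 3 - 1) * (q ^ 3 + 1) = CARD('a) - 1"
    by (simp add: card_field algebra_simps flip: power_add)
  moreover have "c ^ (q ^ 3 + 1) = 1"
    using assms by (simp add: frob_def)
  ultimately obtain b where b: "b \<noteq> 0" "b ^ (q ^ 3 - 1) = c"
    using power_root_exists by blast
  have "b ^ (q ^ 3) = b * b ^ (q ^ 3 - 1)"
    using q_gt_1 by (simp flip: power_Suc)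
  with b show ?thesis
    by (auto simp: frob_def)
qed

text \<open>The factorization of q^6 - 1 behind \<open>hilbert_90\<close>, with the two factors
  exchanged.\<close>

lemma norm_2_surj:
  assumes "n \<noteq> 0" "frob 3 n = n"
  shows "\<exists>x. x \<noteq> 0 \<and> x * frob 3 x = n"
proof -
  have "(q ^ 3 + 1) * (q ^ 3 - 1) = CARD('a) - 1"
    by (simp add: card_field algebra_simps flip: power_add)
  moreover have "n * n ^ (q ^ 3 - 1) = n"
    using q_gt_1 assms(2) by (simp add: frob_def flip: power_Suc)
  then have "n ^ (q ^ 3 - 1) = 1"
    using assms(1) by simp
  ultimately obtain x where "x \<noteq> 0" "x ^ (q ^ 3 + 1) = n"
    using power_root_exists by blast
  then show ?thesis
    by (auto simp: frob_def)
qed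

text \<open>Root extraction is available only in the full field, so the norm from F_{q^6} to F_q is
  inverted first; the norm of the result z to F_{q^3} is then the required s.\<close>

lemma norm_3_surj:
  assumes "e \<noteq> 0" "frob 1 e = e"
  shows "\<exists>s. frob 3 s = s \<and> s * frob 1 s * frob 2 s = e"
proof -
  have "((q ^ 3 + 1) * (1 + q + q ^ 2)) * (q - 1) = CARD('a) - 1"
  proof -
    have "int (((q ^ 3 + 1) * (1 + q + q ^ 2)) * (q - 1)) = int q ^ 6 - 1"
      using q_gt_1 by (simp add: of_nat_diff algebra_simps power_numeral_reduce)
    also have "\<dots> = int (CARD('a) - 1)"
      using q_gt_1 by (simp add: card_field of_nat_diff)
    finally show ?thesis
      by (simp only: of_nat_eq_iff)
  qed
  moreover have "e * e ^ (q - 1) = e"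
    using q_gt_1 assms(2) by (simp add: frob_def flip: power_Suc)
  then have "e ^ (q - 1) = 1"
    using assms(1) by simp
  ultimately obtain z where z: "z ^ ((q ^ 3 + 1) * (1 + q + q ^ 2)) = e"
    using power_root_exists by blast
  define s where "s = z * frob 3 z"
  have "s = z ^ (q ^ 3 + 1)"
    by (simp add: s_def frob_def)
  with z have "s ^ (1 + q + q ^ 2) = e"
    by (simp only: power_mult)
  then have "s * frob 1 s * frob 2 s = e"
    by (simp add: frob_def power_add mult.assoc)
  moreover have "frob 3 s = s"
    by (simp add: s_def frob_simps mult.commute)
  ultimately show ?thesis
    by blast
qed

text \<open>As a polynomial in \<open>c\<close> the sum has degree at most \<open>q\<^sup>2\<close>, fewer than the \<open>q\<^sup>3\<close> available
  values of \<open>c\<close>.\<close>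
lemma trace_nonzero:
  assumes "u \<noteq> 0"
  shows "\<exists>c. frob 3 c = c \<and> c * u + frob 1 c * v + frob 2 c * w \<noteq> 0"
proof (rule ccontr)
  assume "\<not> ?thesis"
  then have all: "c * u + frob 1 c * v + frob 2 c * w = 0" if "frob 3 c = c" for c
    using that by blast
  let ?p = "monom u 1 + monom v q + monom w (q ^ 2)"
  have q: "1 < q" "q < q ^ 2" "q ^ 2 < q ^ 3"
    using q_gt_1 by (simp_all add: power2_eq_square power3_eq_cube)
  have "coeff ?p 1 = u"
    using q by simp
  with assms have ne: "?p \<noteq> 0"
    by (metis coeff_0)
  have "degree ?p \<le> q ^ 2"
    using q by (intro degree_add_le order.trans[OF degree_monom_le]) simp_all
  moreover have "subfld (q ^ 3) \<subseteq> {c. poly ?p c = 0}"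
    using all by (auto simp: mem_subfld_iff poly_monom frob_def mult.commute)
  then have "q ^ 3 \<le> card {c. poly ?p c = 0}"
    using card_mono[of "{c. poly ?p c = 0}" "subfld (q ^ 3)"] card_subfld[of 3] by simp
  ultimately show False
    using card_poly_roots_bound[OF ne] q by linarith
qed

end

subsection \<open>Cross-ratios and Galois descent\<close>

text \<open>With m_i = l_{i+1} - l_i, both sides of the product identity contain each m_i once, and
  the sum identity is polynomial after clearing d_0 d_1 d_2. The irregular signs arise because
  Frobenius sends d_2 to l_0 - l_3 = - d_0.\<close>

lemma cross_ratio_identities:
  fixes l0 l1 l2 l3 l4 l5 A0 A1 A2 :: "'a::field"
  assumes d: "l3 \<noteq> l0" "l4 \<noteq> l1" "l5 \<noteq> l2"
    and A0: "A0 = - ((l0 - l5) * (l3 - l2)) / ((l3 - l0) * (l5 - l2))"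
    and A1: "A1 = (l1 - l0) * (l4 - l3) / ((l3 - l0) * (l4 - l1))"
    and A2: "A2 = (l2 - l1) * (l5 - l4) / ((l4 - l1) * (l5 - l2))"
    and Y: "Y = - ((l1 - l0) * (l3 - l2) * (l5 - l4)) / ((l3 - l0) * (l4 - l1) * (l5 - l2))"
    and Y': "Y' = (l2 - l1) * (l4 - l3) * (l0 - l5) / ((l3 - l0) * (l4 - l1) * (l5 - l2))"
  shows "Y + Y' = A0 + A1 + A2 - 1" and "Y * Y' = A0 * A1 * A2"
proof -
  define d0 d1 d2 where "d0 = l3 - l0" "d1 = l4 - l1" "d2 = l5 - l2"
  define m0 m1 m2 m3 m4 m5 where "m0 = l1 - l0" "m1 = l2 - l1" "m2 = l3 - l2" "m3 = l4 - l3"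
    "m4 = l5 - l4" "m5 = l0 - l5"
  note defs = d0_d1_d2_def m0_m1_m2_m3_m4_m5_def
  have nz: "d0 \<noteq> 0" "d1 \<noteq> 0" "d2 \<noteq> 0"
    using d by (simp_all add: defs)
  note YA = A0[folded defs] A1[folded defs] A2[folded defs] Y[folded defs] Y'[folded defs]
  have A: "A0 = - (m5 * m2 * d1) / (d0 * d1 * d2)" "A1 = m0 * m3 * d2 / (d0 * d1 * d2)"
    "A2 = m1 * m4 * d0 / (d0 * d1 * d2)" "1 = d0 * d1 * d2 / (d0 * d1 * d2)"
    unfolding YA using nz by simp_all
  have "- (m0 * m2 * m4) + m1 * m3 * m5
      = - (m5 * m2 * d1) + m0 * m3 * d2 + m1 * m4 * d0 - d0 * d1 * d2"
    unfolding defs by (simp add: algebra_simps)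
  then show "Y + Y' = A0 + A1 + A2 - 1"
    unfolding YA(4,5) A by (metis add_divide_distrib diff_divide_distrib)
  show "Y * Y' = A0 * A1 * A2"
    unfolding YA by (simp add: mult_ac)
qed

section \<open>The ratio \<open>T\<close> attached to a root Y of the quadratic, and its
  conjugates\<close>

context
  fixes A0 A1 A2 N0 N1 N2 Y0 Y1 T0 T1 T3 :: "'a::field"
  assumes A: "A0 \<noteq> 1" "A1 \<noteq> 1" "A2 \<noteq> 1" "A1 \<noteq> 0"
    and N: "N0 = A0 / (A0 - 1)" "N1 = A1 / (A1 - 1)" "N2 = A2 / (A2 - 1)"
    and sum: "Y0 + Y1 = A0 + A1 + A2 - 1" and prod: "Y0 * Y1 = A0 * A1 * A2"
    and T: "T0 = (Y0 - A0 * A1) / ((1 - A0) * (1 - A1))"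
      "T1 = (Y1 - A1 * A2) / ((1 - A1) * (1 - A2))"
      "T3 = (Y1 - A0 * A1) / ((1 - A0) * (1 - A1))"
begin

text \<open>This is the norm condition that Hilbert 90 needs. The numerator is the quadratic
  evaluated at A0 A1, where it factors as A0 A1 (1 - A0) (1 - A1).\<close>

lemma theta_conjugate: "T0 * T3 = N0 * N1"
proof -
  have "(Y0 - A0 * A1) * (Y1 - A0 * A1) = Y0 * Y1 - A0 * A1 * (Y0 + Y1) + (A0 * A1) ^ 2"
    by (simp add: algebra_simps power2_eq_square)
  also have "\<dots> = A0 * A1 * ((1 - A0) * (1 - A1))"
    unfolding sum prod by (simp add: algebra_simps power2_eq_square)
  finally have "T0 * T3 = A0 * A1 / ((1 - A0) * (1 - A1))"
    using A by (simp add: T)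
  also have "\<dots> = N0 * N1"
    using A by (simp add: N divide_simps) (simp add: algebra_simps)
  finally show ?thesis .
qed

text \<open>Over the common denominator the numerator is exactly the relation \<open>sum\<close>. It
  later makes the leftover scalar \<open>e\<close> invariant under Frobenius.\<close>

lemma theta_linear: "(N2 + T1) * (1 - N0) + (1 + T0) * (1 - N2) = 0"
proof -
  have 1: "1 - N0 = 1 / (1 - A0)" "1 - N2 = 1 / (1 - A2)"
    using A by (simp_all add: N divide_simps)
  have "N2 = - A2 * (1 - A1) / ((1 - A1) * (1 - A2))"
    using A by (simp add: N divide_simps) (simp add: algebra_simps)
  moreover have "Y1 - A2 = - A2 * (1 - A1) + (Y1 - A1 * A2)"
    by (simp add: algebra_simps)
  ultimately have 2: "N2 + T1 = (Y1 - A2) / ((1 - A1) * (1 - A2))"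
    by (simp only: T add_divide_distrib)
  have "1 = (1 - A0) * (1 - A1) / ((1 - A0) * (1 - A1))"
    using A by simp
  moreover have "1 - A0 - A1 + Y0 = (1 - A0) * (1 - A1) + (Y0 - A0 * A1)"
    by (simp add: algebra_simps)
  ultimately have 3: "1 + T0 = (1 - A0 - A1 + Y0) / ((1 - A0) * (1 - A1))"
    by (simp only: T add_divide_distrib)
  have "(N2 + T1) * (1 - N0) + (1 + T0) * (1 - N2)
      = (Y1 - A2 + (1 - A0 - A1 + Y0)) / ((1 - A0) * (1 - A1) * (1 - A2))"
    unfolding 1 2 3 by (simp add: add_divide_distrib mult.commute mult.left_commute)
  also have "Y1 - A2 + (1 - A0 - A1 + Y0) = (Y0 + Y1) - (A0 + A1 + A2 - 1)"
    by simp
  finally show ?thesis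
    by (simp add: sum)
qed

text \<open>This is the compatibility of the two equations on b, written in terms of the ratio
  \<open>T\<close>.\<close>

lemma theta_quadratic: "1 + T0 + T1 * (1 + T0 / N1) = 0"
proof -
  have "T1 * (T0 / N1) = - ((Y0 - A0 * A1) * (Y1 - A1 * A2)) / (A1 * ((1 - A0) * (1 - A1) * (1 - A2)))"
    using A by (simp add: T N divide_simps) (simp add: algebra_simps)
  \<comment> \<open>The relation \<open>prod\<close> makes A1 a factor, which cancels the A1 brought
    in by dividing by N1; afterwards only \<open>sum\<close> is needed.\<close>
  also have "(Y0 - A0 * A1) * (Y1 - A1 * A2) = A1 * (A0 * A2 - A2 * Y0 - A0 * Y1 + A0 * A1 * A2)"
    using prod by (simp add: algebra_simps)
  finally have 1: "T1 * (T0 / N1)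
      = - (A0 * A2 - A2 * Y0 - A0 * Y1 + A0 * A1 * A2) / ((1 - A0) * (1 - A1) * (1 - A2))"
    using A(4) by (simp del: minus_diff_eq minus_add_distrib)
  have 2: "T0 = (Y0 - A0 * A1) * (1 - A2) / ((1 - A0) * (1 - A1) * (1 - A2))"
    "T1 = (Y1 - A1 * A2) * (1 - A0) / ((1 - A0) * (1 - A1) * (1 - A2))"
    "1 = (1 - A0) * (1 - A1) * (1 - A2) / ((1 - A0) * (1 - A1) * (1 - A2))"
    using A by (simp_all add: T)
  have "1 + T0 + T1 * (1 + T0 / N1) = 1 + T0 + T1 + T1 * (T0 / N1)"
    by (simp add: algebra_simps)
  also have "\<dots> = ((1 - A0) * (1 - A1) * (1 - A2) + (Y0 - A0 * A1) * (1 - A2)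
      + (Y1 - A1 * A2) * (1 - A0) - (A0 * A2 - A2 * Y0 - A0 * Y1 + A0 * A1 * A2))
      / ((1 - A0) * (1 - A1) * (1 - A2))"
    unfolding 1 add_divide_distrib diff_divide_distrib
    by (simp only: 2[symmetric] minus_divide_left[symmetric] add_uminus_conv_diff diff_divide_distrib[symmetric] add_divide_distrib[symmetric])
  also have "(1 - A0) * (1 - A1) * (1 - A2) + (Y0 - A0 * A1) * (1 - A2)
      + (Y1 - A1 * A2) * (1 - A0) - (A0 * A2 - A2 * Y0 - A0 * Y1 + A0 * A1 * A2)
      = (Y0 + Y1) - (A0 + A1 + A2 - 1)"
    by (simp add: algebra_simps)
  finally show ?thesis
    by (simp add: sum)
qed

end

text \<open>Substituting the ratio b3 / b0 = T / (a0 a4) reduces the first claim, the quotient of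
  the two equations on b, to \<open>quad\<close>. The second claim, which expresses Frobenius
  invariance of the scalar still to be corrected, then follows from \<open>lin\<close>.\<close>

lemma scaling_algebra:
  fixes a0 a1 a2 a4 a5 b0 b1 b3 b4 N0 N1 N2 T T1 :: "'a::field"
  assumes a: "a0 \<noteq> 0" "a1 \<noteq> 0" "a4 \<noteq> 0" "a5 \<noteq> 0"
    and N: "N1 = a1 * a4" "N2 = a2 * a5"
    and b: "b3 = b0 * (T / (a0 * a4))" "b4 = b1 * (T1 / (a1 * a5))"
    and lin: "(N2 + T1) * (1 - N0) + (1 + T) * (1 - N2) = 0"
    and quad: "1 + T + T1 * (1 + T / N1) = 0"
  shows "b1 * (b0 + a0 * a4 * b3) = - a5 * b4 * (a1 * b0 + a0 * b3)"
    and "b4 * (a1 * b0 + a0 * b3) * (1 - N2) = b0 * (a2 * b1 + a1 * b4) * (1 - N0)"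
proof -
  have 1: "a1 * b0 + a0 * b3 = a1 * b0 * (1 + T / N1)"
    using a by (simp add: N b field_simps)
  have 2: "a5 * b4 * a1 = b1 * T1"
    using a by (simp add: b)
  have 3: "T1 * (1 + T / N1) = - (1 + T)"
    using quad by (metis eq_neg_iff_add_eq_0 add.commute)
  have "a5 * b4 * (a1 * b0 + a0 * b3) = (a5 * b4 * a1) * b0 * (1 + T / N1)"
    unfolding 1 by (simp add: mult_ac)
  also have "\<dots> = b1 * b0 * (T1 * (1 + T / N1))"
    unfolding 2 by (simp add: mult_ac)
  finally have 4: "a5 * b4 * (a1 * b0 + a0 * b3) = - b1 * b0 * (1 + T)"
    unfolding 3 by (simp add: algebra_simps)
  have 5: "a0 * a4 * b3 = b0 * T"
    using a by (simp add: b)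
  have "- a5 * b4 * (a1 * b0 + a0 * b3) = - (a5 * b4 * (a1 * b0 + a0 * b3))"
    by simp
  then show "b1 * (b0 + a0 * a4 * b3) = - a5 * b4 * (a1 * b0 + a0 * b3)"
    unfolding 4 5 by (simp add: algebra_simps)
  have "a5 * (b4 * (a1 * b0 + a0 * b3) * (1 - N2)) = (a5 * b4 * (a1 * b0 + a0 * b3)) * (1 - N2)"
    by (simp add: mult_ac)
  also have "\<dots> = b1 * b0 * (- ((1 + T) * (1 - N2)))"
    unfolding 4 by (simp add: algebra_simps)
  also have "- ((1 + T) * (1 - N2)) = (N2 + T1) * (1 - N0)"
    using lin by (metis eq_neg_iff_add_eq_0)
  also have "b1 * b0 * ((N2 + T1) * (1 - N0)) = b0 * (a2 * a5 * b1 + b1 * T1) * (1 - N0)"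
    by (simp add: N algebra_simps)
  also have "\<dots> = a5 * (b0 * (a2 * b1 + a1 * b4) * (1 - N0))"
    unfolding 2[symmetric] by (simp add: algebra_simps)
  finally show "b4 * (a1 * b0 + a0 * b3) * (1 - N2) = b0 * (a2 * b1 + a1 * b4) * (1 - N0)"
    using a(4) by (simp only: mult_cancel_left simp_thms)
qed

text \<open>The left side is the square of the semilinear map, a combination of x2 and x5 only; the
  two hypotheses on b are what its two coefficients require.\<close>

lemma semilinear_square_algebra:
  fixes a0 a1 a4 a5 b0 b1 b3 b4 b5 x2 x5 n0 n1 :: "'a::field"
  assumes n: "n0 \<noteq> 0" "n1 \<noteq> 0" "b5 \<noteq> 0"
    and b1: "b4 * b5 * (a1 * b0 + a0 * b3) = n0 * n1"
    and b2: "b1 * b5 * (b0 + a0 * a4 * b3) = - a5 * n0 * n1"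
  shows "- (b0 * (- (b1 * x2 - a1 * b4 * x5) / n1) - a0 * b3 * (- (b4 * x5 - a4 * b1 * x2) / n1)) / n0
    = - (a5 * x2 + x5) / b5"
proof -
  have "- (b0 * (- (b1 * x2 - a1 * b4 * x5) / n1) - a0 * b3 * (- (b4 * x5 - a4 * b1 * x2) / n1)) / n0
    = (b1 * (b0 + a0 * a4 * b3) * x2 - b4 * (a1 * b0 + a0 * b3) * x5) / (n0 * n1)"
    using n by (simp add: divide_simps) (simp add: algebra_simps)
  also have "\<dots> = ((b1 * b5 * (b0 + a0 * a4 * b3)) * x2 - (b4 * b5 * (a1 * b0 + a0 * b3)) * x5)
      / (n0 * n1) / b5"
    using n by (simp add: divide_simps) (simp add: algebra_simps)
  also have "\<dots> = - (a5 * x2 + x5) / b5"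
    unfolding b1 b2 using n by (simp add: divide_simps) (simp add: algebra_simps)
  finally show ?thesis .
qed

context sextic_field
begin

text \<open>The ratio \<open>T\<close> and Hilbert 90 determine b up to a factor from F_{q^3}. The
  quotient of the two equations is insensitive to that factor, so only the first must be
  normalized.\<close>

lemma scaling_exists:
  assumes a: "a \<noteq> 0" and N: "N0 = a * frob 3 a" "N0 \<noteq> 1" and A: "A = N0 / (N0 - 1)"
    and sum: "Y + frob 1 Y = A + frob 1 A + frob 2 A - 1" and prod: "Y * frob 1 Y = A * frob 1 A * frob 2 A"
  shows "\<exists>b. frob 4 b * frob 5 b * (frob 1 a * b + a * frob 3 b) = (1 - N0) * (1 - frob 1 N0) \<and>
             frob 1 b * frob 5 b * (b + a * frob 4 a * frob 3 b) = - frob 5 a * (1 - N0) * (1 - frob 1 N0)"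
proof -
  have N3: "frob 3 N0 = N0"
    by (simp add: N frob_simps mult.commute)
  have A3: "frob 3 A = A"
    by (simp add: A frob_simps N3)
  have A1: "A \<noteq> 1" "A \<noteq> 0"
    using a N by (auto simp: A)
  have fA: "frob i A \<noteq> 1" "frob i A \<noteq> 0" for i
    using A1 frob_inj[of i A 1] by auto
  have frN: "frob i N0 = frob i A / (frob i A - 1)" for i
  proof -
    have "N0 = A / (A - 1)"
      using N(2) by (simp add: A divide_simps)
    then show ?thesis
      by (metis frob_diff frob_divide frob_one)
  qed
  \<comment> \<open>The sum is a trace minus 1, hence fixed by Frobenius; comparing Y + Y^q with its
    q-th power puts Y in F_{q^2}.\<close>
  have "frob 1 (Y + frob 1 Y) = Y + frob 1 Y"
    unfolding sum by (simp add: frob_simps A3)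
  moreover have "frob 1 (frob 1 Y) = frob 2 Y"
    by (simp add: frob_simps)
  ultimately have Y2: "frob 2 Y = Y"
    by (metis frob_add add.commute add_left_cancel)
  have "frob 3 Y = frob 1 (frob 2 Y)"
    by (simp add: frob_fr)
  then have Y3: "frob 3 Y = frob 1 Y"
    by (simp add: Y2)
  define T where "T = (Y - A * frob 1 A) / ((1 - A) * (1 - frob 1 A))"
  have T1: "frob 1 T = (frob 1 Y - frob 1 A * frob 2 A) / ((1 - frob 1 A) * (1 - frob 2 A))"
    by (simp add: T_def frob_simps)
  have T3: "frob 3 T = (frob 1 Y - A * frob 1 A) / ((1 - A) * (1 - frob 1 A))"
    using frob_fr[of 1 3 A] by (simp add: T_def frob_simps A3 Y3)
  note theta = A1(1) fA(1)[of 1] fA(1)[of 2] fA(2)[of 1] frN[of 0, unfolded frob_0] frN[of 1] frN[of 2]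
    sum prod T_def T1 T3
  have conj: "T * frob 3 T = N0 * frob 1 N0"
    and lin: "(frob 2 N0 + frob 1 T) * (1 - N0) + (1 + T) * (1 - frob 2 N0) = 0"
    and quad: "1 + T + frob 1 T * (1 + T / frob 1 N0) = 0"
    by (rule theta_conjugate[OF theta] theta_linear[OF theta] theta_quadratic[OF theta])+
  have frN0: "frob 1 N0 = frob 1 a * frob 4 a" "frob 2 N0 = frob 2 a * frob 5 a"
    by (simp_all add: N frob_simps)
  have fN: "frob i N0 \<noteq> 1" for i
    using N(2) frob_inj[of i N0 1] by auto
  have ane: "frob i a \<noteq> 0" for i
    using a by simp
  define c where "c = T / (a * frob 4 a)"
  have "c * frob 3 c = (T * frob 3 T) / (N0 * frob 1 N0)"
    by (simp add: c_def N(1) frob_simps mult_ac)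
  also have "\<dots> = 1"
    unfolding conj using a by (simp add: N(1))
  finally obtain b0 where b0: "b0 \<noteq> 0" "frob 3 b0 = b0 * c"
    using hilbert_90 by blast
  have b03: "frob 3 b0 = b0 * (T / (a * frob 4 a))"
    by (simp add: b0 c_def)
  have "frob 4 b0 = frob 1 (frob 3 b0)"
    by (simp add: frob_fr)
  also have "\<dots> = frob 1 b0 * (frob 1 T / (frob 1 a * frob 5 a))"
    unfolding b03 by (simp add: frob_simps)
  finally have b04: "frob 4 b0 = frob 1 b0 * (frob 1 T / (frob 1 a * frob 5 a))" .
  note alg = scaling_algebra[OF a ane[of 1] ane[of 4] ane[of 5] frN0 b03 b04 lin quad]
  define G where "G = frob 1 a * b0 + a * frob 3 b0"
  \<comment> \<open>If G vanished, then T = - N1, while \<open>quad\<close> would give T = - 1, so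
    N1 = 1.\<close>
  have G: "G \<noteq> 0"
  proof
    assume "G = 0"
    moreover have "G = frob 1 a * b0 * (1 + T / frob 1 N0)"
      unfolding G_def b03 frN0 using ane[of 1] ane[of 4] a by (simp add: field_simps)
    ultimately have "1 + T / frob 1 N0 = 0"
      using ane[of 1] b0(1) by simp
    with quad have "1 + T = 0"
      by simp
    then have "T = - 1"
      by (simp add: eq_neg_iff_add_eq_0 add.commute)
    with \<open>1 + T / frob 1 N0 = 0\<close> have "frob 1 N0 = 1"
      by (auto simp: field_simps)
    with fN[of 1] show False ..
  qed
  \<comment> \<open>The factor by which \<open>b0\<close> misses the first equation. Scaling by s in
    F_{q^3} multiplies it by s_4 s_5 s = s_1 s_2 s, the norm of s to F_q.\<close>
  define e where "e = frob 4 b0 * frob 5 b0 * G / ((1 - N0) * (1 - frob 1 N0))"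
  have ne: "1 - frob i N0 \<noteq> 0" for i
    using fN[of i] by simp
  have e0: "e \<noteq> 0"
    unfolding e_def using b0(1) G ne[of 0] ne[of 1] by simp
  have "frob 1 e = frob 5 b0 * b0 * (frob 2 a * frob 1 b0 + frob 1 a * frob 4 b0) / ((1 - frob 1 N0) * (1 - frob 2 N0))"
    by (simp add: e_def G_def frob_simps)
  also have "\<dots> = frob 5 b0 * (b0 * (frob 2 a * frob 1 b0 + frob 1 a * frob 4 b0) * (1 - N0))
      / ((1 - N0) * (1 - frob 1 N0) * (1 - frob 2 N0))"
    using ne[of 0] by (simp add: mult_ac)
  also have "\<dots> = e"
    unfolding alg(2)[symmetric] e_def G_def using ne[of 2] by (simp add: mult_ac)
  finally have "frob 1 (1 / e) = 1 / e"
    by (simp add: frob_divide)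
  then obtain s where s: "frob 3 s = s" "s * frob 1 s * frob 2 s = 1 / e"
    using norm_3_surj[of "1 / e"] e0 by auto
  have s45: "frob 4 s = frob 1 s" "frob 5 s = frob 2 s"
    using frob_fr[of 1 3 s] frob_fr[of 2 3 s] by (simp_all add: s)
  define b where "b = s * b0"
  have b: "frob 1 b = frob 1 s * frob 1 b0" "frob 3 b = s * frob 3 b0" "frob 4 b = frob 1 s * frob 4 b0"
    "frob 5 b = frob 2 s * frob 5 b0"
    by (simp_all add: b_def frob_mult s45 s(1))
  have b1: "frob 4 b * frob 5 b * (frob 1 a * b + a * frob 3 b) = (1 - N0) * (1 - frob 1 N0)"
  proof -
    have "frob 4 b * frob 5 b * (frob 1 a * b + a * frob 3 b)
        = (s * frob 1 s * frob 2 s) * (frob 4 b0 * frob 5 b0 * G)"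
      unfolding b G_def by (simp add: b_def algebra_simps)
    also have "frob 4 b0 * frob 5 b0 * G = e * ((1 - N0) * (1 - frob 1 N0))"
      using ne[of 0] ne[of 1] by (simp add: e_def)
    finally show ?thesis
      unfolding s(2) using e0 by simp
  qed
  have "frob 1 b * (b + a * frob 4 a * frob 3 b) = - frob 5 a * frob 4 b * (frob 1 a * b + a * frob 3 b)"
  proof -
    have "frob 1 b * (b + a * frob 4 a * frob 3 b)
        = s * frob 1 s * (frob 1 b0 * (b0 + a * frob 4 a * frob 3 b0))"
      unfolding b by (simp add: b_def algebra_simps)
    also have "\<dots> = - frob 5 a * frob 4 b * (frob 1 a * b + a * frob 3 b)"
      unfolding alg(1) b by (simp add: b_def algebra_simps)
    finally show ?thesis .
  qed
  then have "frob 5 b * (frob 1 b * (b + a * frob 4 a * frob 3 b))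
      = - frob 5 a * (frob 4 b * frob 5 b * (frob 1 a * b + a * frob 3 b))"
    by (simp only: mult_ac)
  then have "frob 1 b * frob 5 b * (b + a * frob 4 a * frob 3 b) = - frob 5 a * (1 - N0) * (1 - frob 1 N0)"
    unfolding b1 by (simp only: mult_ac)
  with b1 show ?thesis
    by blast
qed

text \<open>For \<open>\<phi> x = - (b * x ^ q - a * b ^ (q ^ 3) * x ^ (q ^ 4)) / (1 - N0)\<close> the two equations on \<open>b\<close> say
  that \<open>\<phi> (\<phi> x) = - (\<alpha> * x ^ (q ^ 2) + x ^ (q ^ 5)) / b ^ (q ^ 5)\<close>, whence \<open>\<phi> (\<phi> (\<phi> x)) = x\<close>. As
  \<open>\<phi>\<close> is semilinear over the subfield of order \<open>q ^ 3\<close>, its fixed points span the field over that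
  subfield (Galois descent); they are produced as traces \<open>x + \<phi> x + \<phi> (\<phi> x)\<close>.\<close>
lemma fixed_points_exist:
  assumes \<alpha>: "\<alpha> \<noteq> 0" and a: "a = frob 1 \<alpha>" and N: "N0 = a * frob 3 a" "N0 \<noteq> 1"
    and b1: "frob 4 b * frob 5 b * (frob 1 a * b + a * frob 3 b) = (1 - N0) * (1 - frob 1 N0)"
    and b2: "frob 1 b * frob 5 b * (b + a * frob 4 a * frob 3 b) = - frob 5 a * (1 - N0) * (1 - frob 1 N0)"
  shows "\<exists>u v. u \<noteq> 0 \<and> frob 3 (v / u) \<noteq> v / u \<and>
    frob 5 u + \<alpha> * frob 2 u = - frob 5 b * u \<and> frob 5 v + \<alpha> * frob 2 v = - frob 5 b * v"
proof -
  have N3: "frob 3 N0 = N0"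
    by (simp add: N frob_simps mult.commute)
  have N4: "frob 4 N0 = frob 1 N0"
    using frob_fr[of 1 3 N0] by (simp add: N3)
  have N5: "frob 5 N0 = frob 2 N0"
    using frob_fr[of 2 3 N0] by (simp add: N3)
  have Nne: "1 - frob i N0 \<noteq> 0" for i
    using N(2) frob_inj[of i N0 1] by auto
  have bne: "frob i b \<noteq> 0" for i
    using b1 Nne[of 0] Nne[of 1] by auto
  have a5: "frob 5 a = \<alpha>"
    by (simp add: a frob_fr)
  \<comment> \<open>Obtained from x + a x_3 = - b x_1 and x_3 + a_3 x = - b_3 x_4, the Frobenius
    images of the equation to be solved, by eliminating x_3.\<close>
  define \<phi> where "\<phi> = (\<lambda>x. - (b * frob 1 x - a * frob 3 b * frob 4 x) / (1 - N0))"
  define \<psi> where "\<psi> = (\<lambda>x. - (\<alpha> * frob 2 x + frob 5 x) / frob 5 b)"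
  have add: "\<phi> (x + y) = \<phi> x + \<phi> y" for x y
    by (simp add: \<phi>_def frob_add algebra_simps flip: add_divide_distrib)
  have semi: "\<phi> (c * x) = frob 1 c * \<phi> x" if c: "frob 3 c = c" for c x
  proof -
    have "frob 4 c = frob 1 c"
      using frob_fr[of 1 3 c] by (simp add: c)
    then show ?thesis
      by (simp add: \<phi>_def frob_mult algebra_simps del: One_nat_def)
  qed
  have sq: "\<phi> (\<phi> x) = \<psi> x" for x
  proof -
    have 1: "frob 1 (\<phi> x) = - (frob 1 b * frob 2 x - frob 1 a * frob 4 b * frob 5 x) / (1 - frob 1 N0)"
      by (simp add: \<phi>_def frob_simps)
    have 4: "frob 4 (\<phi> x) = - (frob 4 b * frob 5 x - frob 4 a * frob 1 b * frob 2 x) / (1 - frob 1 N0)"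
      using N4 by (simp add: \<phi>_def frob_simps)
    have "\<phi> (\<phi> x) = - (b * frob 1 (\<phi> x) - a * frob 3 b * frob 4 (\<phi> x)) / (1 - N0)"
      by (simp add: \<phi>_def)
    also have "\<dots> = - (frob 5 a * frob 2 x + frob 5 x) / frob 5 b"
      unfolding 1 4
      by (rule semilinear_square_algebra[OF Nne[of 0, unfolded frob_0] Nne[of 1] bne[of 5] b1 b2])
    finally show ?thesis
      by (simp add: \<psi>_def a5)
  qed
  \<comment> \<open>By that elimination \<open>\<phi>\<close> inverts \<open>\<psi>\<close>,
    whatever the nonzero b; together with \<open>sq\<close> it has order three.\<close>
  have cube: "\<psi> (\<phi> x) = x" for x
  proof -
    have 2: "frob 2 (\<phi> x) = - (frob 2 b * frob 3 x - frob 2 a * frob 5 b * x) / (1 - frob 2 N0)"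
      by (simp add: \<phi>_def frob_simps)
    have 5: "frob 5 (\<phi> x) = - (frob 5 b * x - \<alpha> * frob 2 b * frob 3 x) / (1 - frob 2 N0)"
      using N5 a5 by (simp add: \<phi>_def frob_simps)
    have "frob 2 N0 = frob 2 a * \<alpha>"
      using a5 by (simp add: N frob_simps)
    moreover have "\<psi> (\<phi> x) = (1 - \<alpha> * frob 2 a) * frob 5 b * x / ((1 - frob 2 N0) * frob 5 b)"
      unfolding \<psi>_def 2 5 using Nne[of 2] bne[of 5]
      by (simp add: divide_simps) (simp add: algebra_simps)
    ultimately show ?thesis
      using Nne[of 2] bne[of 5] by (simp add: mult.commute)
  qed
  define tr where "tr = (\<lambda>x. x + \<phi> x + \<psi> x)"
  have tr_fixed: "\<phi> (tr x) = tr x" for x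
  proof -
    have "\<phi> (\<psi> x) = x"
      by (metis sq cube)
    then show ?thesis
      by (simp add: tr_def add sq)
  qed
  have tr_scale: "tr (c * x) = c * x + frob 1 c * \<phi> x + frob 2 c * \<psi> x" if c: "frob 3 c = c" for c x
  proof -
    have "frob 3 (frob 1 c) = frob 1 c"
      using frob_fr[of 1 3 c] by (simp add: c frob_fr)
    then have "\<phi> (\<phi> (c * x)) = frob 1 (frob 1 c) * \<phi> (\<phi> x)"
      by (simp add: semi c del: One_nat_def)
    moreover have "frob 1 (frob 1 c) = frob 2 c"
      by (simp add: frob_simps)
    ultimately have "\<psi> (c * x) = frob 2 c * \<psi> x"
      by (simp only: sq)
    then show ?thesis
      by (simp only: tr_def semi[OF c])
  qed
  have eigen: "frob 5 x + \<alpha> * frob 2 x = - frob 5 b * x" if "\<phi> x = x" for x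
  proof -
    have "\<psi> x = x"
      using sq[of x] that by simp
    moreover have "frob 5 x + \<alpha> * frob 2 x = - frob 5 b * \<psi> x"
      using bne[of 5] by (simp add: \<psi>_def add.commute)
    ultimately show ?thesis
      by simp
  qed
  obtain c where "frob 3 c = c" "c * 1 + frob 1 c * \<phi> 1 + frob 2 c * \<psi> 1 \<noteq> 0"
    using trace_nonzero[of 1] by auto
  then have "tr (c * 1) \<noteq> 0"
    by (metis tr_scale)
  then obtain u where u: "u \<noteq> 0" "\<phi> u = u"
    using tr_fixed by blast
  \<comment> \<open>\<open>D\<close> is linear over F_{q^3} and vanishes exactly on the
    F_{q^3}-multiples of u, so a trace with nonzero \<open>D\<close> is a second, independent fixed
    point.\<close>
  define D where "D = (\<lambda>x. frob 3 x * u - x * frob 3 u)"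
  have D_add: "D (x + y) = D x + D y" for x y
    by (simp add: D_def frob_add algebra_simps)
  have D_scale: "D (c * x) = c * D x" if "frob 3 c = c" for c x
    by (simp add: D_def frob_mult that algebra_simps)
  have "\<exists>x. D x \<noteq> 0"
  proof (rule ccontr)
    assume "\<not> ?thesis"
    then have D0: "D x = 0" for x
      by simp
    have "frob 3 x = x" for x
    proof -
      have "frob 3 (x * u) * u - x * u * frob 3 u = 0"
        using D0[of "x * u"] by (simp add: D_def)
      then have "(frob 3 x - x) * (u * frob 3 u) = 0"
        by (simp add: frob_mult algebra_simps)
      with u(1) show ?thesis
        by simp
    qed
    then have "subfld (q ^ 3) = (UNIV :: 'a set)"
      by (auto simp: mem_subfld_iff)
    then have "q ^ 3 = q ^ 6"
      using card_subfld[of 3] card_field by simp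
    with q_gt_1 show False
      by simp
  qed
  then obtain x where "D x \<noteq> 0"
    by blast
  then obtain c where c: "frob 3 c = c" "c * D x + frob 1 c * D (\<phi> x) + frob 2 c * D (\<psi> x) \<noteq> 0"
    using trace_nonzero[of "D x"] by blast
  have "frob 3 (frob i c) = frob i c" for i
    using frob_fr_add[of 3 i c] frob_fr_add[of i 3 c] by (simp add: c(1) add.commute)
  then have "D (tr (c * x)) = c * D x + frob 1 c * D (\<phi> x) + frob 2 c * D (\<psi> x)"
    by (simp add: tr_scale c(1) D_add D_scale)
  with c(2) obtain v where v: "\<phi> v = v" "D v \<noteq> 0"
    using tr_fixed by metis
  have "frob 3 (v / u) \<noteq> v / u"
    using v(2) u(1) by (auto simp: D_def frob_divide frac_eq_eq)
  with u v eigen show ?thesis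
    by blast
qed

end

subsection \<open>Scatteredness and the quadratic\<close>

lemma power_iterate_fixed: "z ^ m = z \<Longrightarrow> z ^ (m ^ k) = (z::'a::monoid_mult)"
  by (induction k) (simp_all add: power_mult)

context sextic_field
begin

lemma alg_closure_power_q_add: "(x + y) ^ q = x ^ q + (y ^ q :: 'a alg_closure)"
proof -
  obtain n where "q = CHAR('a alg_closure) ^ n"
    using q_char_power by auto
  then show ?thesis
    by (rule freshmans_dream'[rotated]) (simp add: prime_char)
qed

lemma alg_closure_power_q_diff: "(x - y) ^ q = x ^ q - (y ^ q :: 'a alg_closure)"
  using alg_closure_power_q_add[of "x - y" y] by (simp add: algebra_simps)

text \<open>For a root z in the closure, z^q is a root of the same quadratic, hence z or t - z.
  Either way z is fixed by the q^2-power, and F_{q^2} lies in F_{q^6}.\<close>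

lemma quadratic_root_exists:
  assumes "frob 1 t = t" "frob 1 m = m"
  shows "\<exists>y. y ^ 2 - t * y + m = 0"
proof -
  have "\<exists>y. poly [:m, - t, 1:] y = 0"
  proof (rule poly_root_in_field)
    fix z assume "poly (map_poly to_ac [:m, - t, 1:]) z = 0"
    then have z: "z ^ 2 = to_ac t * z - to_ac m"
      by (simp add: map_poly_pCons algebra_simps power2_eq_square eq_neg_iff_add_eq_0)
    have t: "to_ac t ^ q = to_ac t" and m: "to_ac m ^ q = to_ac m"
      using assms by (simp_all add: frob_def flip: to_ac_power)
    have "(z ^ q) ^ 2 = (z ^ 2) ^ q"
      by (simp add: mult.commute flip: power_mult)
    also have "\<dots> = to_ac t * z ^ q - to_ac m"
      by (simp add: z alg_closure_power_q_diff power_mult_distrib t m)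
    finally have 1: "(z ^ q) ^ 2 - to_ac t * z ^ q = - to_ac m"
      by simp
    have 2: "z ^ 2 - to_ac t * z = - to_ac m"
      by (simp add: z)
    have "(z ^ q - z) * (z ^ q - (to_ac t - z)) = ((z ^ q) ^ 2 - to_ac t * z ^ q) - (z ^ 2 - to_ac t * z)"
      by (simp add: algebra_simps power2_eq_square)
    then have "(z ^ q - z) * (z ^ q - (to_ac t - z)) = 0"
      unfolding 1 2 by simp
    then consider "z ^ q = z" | "z ^ q = to_ac t - z"
      by auto
    then have "(z ^ q) ^ q = z"
      by cases (simp_all add: alg_closure_power_q_diff t)
    then have "z ^ (q ^ 2) = z"
      by (simp add: power2_eq_square power_mult)
    then have "z ^ ((q ^ 2) ^ 3) = z"
      by (rule power_iterate_fixed)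
    then show "z ^ CARD('a) = z"
      by (simp add: card_field flip: power_mult)
  qed simp
  then show ?thesis
    by (auto simp: algebra_simps power2_eq_square)
qed

text \<open>A quadratic over the subfield of order \<open>q\<close> either has two distinct roots there or is
  \<open>(X - Y) (X - Y ^ q)\<close>.\<close>
lemma conjugate_roots_iff:
  assumes t: "frob 1 t = t" and m: "frob 1 m = m"
  shows "(\<exists>Y. Y + frob 1 Y = t \<and> Y * frob 1 Y = m) \<longleftrightarrow>
    \<not> (\<exists>y\<^sub>1\<in>subfld q. \<exists>y\<^sub>2\<in>subfld q. y\<^sub>1 \<noteq> y\<^sub>2 \<and> (\<forall>Y\<in>{y\<^sub>1, y\<^sub>2}. Y ^ 2 - t * Y + m = 0))"
    (is "?L \<longleftrightarrow> \<not> ?R")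
proof
  assume ?L
  then obtain Y where Y: "t = Y + frob 1 Y" "m = Y * frob 1 Y"
    by blast
  have root: "y = Y \<or> y = frob 1 Y" if "y ^ 2 - t * y + m = 0" for y
  proof -
    have "y ^ 2 - t * y + m = (y - Y) * (y - frob 1 Y)"
      by (simp add: Y algebra_simps power2_eq_square)
    with that show ?thesis
      by simp
  qed
  show "\<not> ?R"
  proof
    assume ?R
    then obtain y z where yz: "frob 1 y = y" "frob 1 z = z" "y \<noteq> z" "y = Y \<or> y = frob 1 Y" "z = Y \<or> z = frob 1 Y"
      using root by (auto simp: mem_subfld_q_iff)
    then have "frob 1 Y = Y"
      by auto
    with yz show False
      by metis
  qed
next
  assume R: "\<not> ?R"
  obtain Y where Y: "Y ^ 2 - t * Y + m = 0"
    using quadratic_root_exists[OF t m] by blast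
  have other: "Z = Y \<or> Z = t - Y" if "Z ^ 2 - t * Z + m = 0" for Z
  proof -
    have "(Z - Y) * (Z - (t - Y)) = (Z ^ 2 - t * Z + m) - (Y ^ 2 - t * Y + m)"
      by (simp add: algebra_simps power2_eq_square)
    with that Y show ?thesis
      by simp
  qed
  have tY: "(t - Y) ^ 2 - t * (t - Y) + m = 0"
    using Y by (simp add: algebra_simps power2_eq_square)
  have "frob 1 (Y ^ 2 - t * Y + m) = 0"
    by (simp add: Y)
  then have "(frob 1 Y) ^ 2 - t * frob 1 Y + m = 0"
    by (simp add: frob_simps power2_eq_square t m del: One_nat_def)
  then have "frob 1 Y = Y \<or> frob 1 Y = t - Y"
    by (rule other)
  \<comment> \<open>If Y lies in F_q, so does the other root t - Y; without two distinct roots there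
    they coincide.\<close>
  moreover have "frob 1 Y = t - Y" if "frob 1 Y = Y"
  proof -
    have "Y \<in> subfld q" "t - Y \<in> subfld q"
      using that t by (simp_all add: mem_subfld_q_iff frob_diff del: One_nat_def)
    with R Y tY have "Y = t - Y"
      by blast
    with that show ?thesis
      by simp
  qed
  ultimately have "frob 1 Y = t - Y"
    by blast
  moreover have "Y * (t - Y) = m"
    using Y by (simp add: algebra_simps power2_eq_square)
  ultimately show ?L
    by (intro exI[of _ Y]) simp
qed

lemma frob_fixed: "frob 1 c = c \<Longrightarrow> frob i c = c"
  unfolding frob_def using power_iterate_fixed[of c q i] by simp

lemma rel_trace_3: "rel_trace q 3 x = x + frob 1 x + frob 2 x"
  by (simp add: rel_trace_def frob_def numeral_3_eq_3 numeral_2_eq_2)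

lemma rel_norm_3: "rel_norm q 3 x = x * frob 1 x * frob 2 x"
  by (simp add: rel_norm_def frob_def numeral_3_eq_3 numeral_2_eq_2)

text \<open>The vectors of U on the point of x correspond to the y with y f(x) = x f(y). These
  always include the q multiples of x by F_q, so weight one means that there are no others.\<close>

lemma scattered_U_f3_iff:
  "scattered q (U_f3 q \<alpha>) \<longleftrightarrow>
    (\<forall>x y. x \<noteq> 0 \<longrightarrow> y * (frob 5 x + \<alpha> * frob 2 x) = x * (frob 5 y + \<alpha> * frob 2 y) \<longrightarrow> frob 1 (y / x) = y / x)"
proof -
  define f where "f = (\<lambda>x. frob 5 x + \<alpha> * frob 2 x)"
  have f_add: "f (x + y) = f x + f y" for x y
    by (simp add: f_def frob_add algebra_simps)
  have f_scale: "f (c * x) = c * f x" if "c \<in> subfld q" for c x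
    using that frob_fixed[of c] by (simp add: f_def frob_mult mem_subfld_q_iff algebra_simps)
  have U: "U_f3 q \<alpha> = range (\<lambda>x. (x, f x))"
    by (simp add: U_f3_def f_def frob_def)
  have lin: "linear_set (U_f3 q \<alpha>) = {proj_point (x, f x) |x. x \<noteq> 0}"
    using q_gt_1 linear_set_U_f3[of q \<alpha>] by (simp add: f_def frob_def)
  have weight: "weight q (U_f3 q \<alpha>) (proj_point (x, f x)) = 1 \<longleftrightarrow>
      (\<forall>y. y * f x = x * f y \<longrightarrow> y / x \<in> subfld q)" if x: "x \<noteq> 0" for x
  proof -
    let ?W = "{y. y * f x = x * f y}"
    let ?V = "U_f3 q \<alpha> \<inter> proj_point (x, f x)"
    have mem: "(y, f y) \<in> proj_point (x, f x) \<longleftrightarrow> y \<in> ?W" for y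
    proof
      assume "(y, f y) \<in> proj_point (x, f x)"
      then show "y \<in> ?W"
        by (auto simp: proj_point_def vscale_def)
    next
      assume "y \<in> ?W"
      then have "(y, f y) = vscale (y / x) (x, f x)"
        using x by (simp add: vscale_def field_simps)
      then show "(y, f y) \<in> proj_point (x, f x)"
        by (simp add: proj_point_def)
    qed
    have V: "?V = (\<lambda>y. (y, f y)) ` ?W"
      using mem by (auto simp: U)
    have f0: "f 0 = 0"
      by (simp add: f_def)
    have W_add: "y + z \<in> ?W" if "y \<in> ?W" "z \<in> ?W" for y z
      using that by (simp add: f_add algebra_simps)
    have W_scale: "c * y \<in> ?W" if "y \<in> ?W" "c \<in> subfld q" for c y
      using that by (simp add: f_scale mult.assoc mult.left_commute[of x c])
    have "subspace_over (subfld q) ?V"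
      unfolding V subspace_over_def
    proof (intro conjI ballI)
      show "0 \<in> (\<lambda>y. (y, f y)) ` ?W"
        by (rule image_eqI[of _ _ 0]) (simp_all add: f0 zero_prod_def)
    next
      fix u v assume "u \<in> (\<lambda>y. (y, f y)) ` ?W" "v \<in> (\<lambda>y. (y, f y)) ` ?W"
      then obtain y z where "u = (y, f y)" "v = (z, f z)" "y \<in> ?W" "z \<in> ?W"
        by (elim imageE)
      then show "u + v \<in> (\<lambda>y. (y, f y)) ` ?W"
        by (intro image_eqI[of _ _ "y + z"] W_add) (simp_all only: f_add add_Pair)
    next
      fix c :: 'a and v assume c: "c \<in> subfld q" and "v \<in> (\<lambda>y. (y, f y)) ` ?W"
      then obtain y where "v = (y, f y)" "y \<in> ?W"
        by (elim imageE)
      then show "vscale c v \<in> (\<lambda>y. (y, f y)) ` ?W"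
        using c by (intro image_eqI[of _ _ "c * y"] W_scale) (simp_all only: f_scale vscale_def fst_conv snd_conv)
    qed
    then have "weight q (U_f3 q \<alpha>) (proj_point (x, f x)) = 1 \<longleftrightarrow> card ?V = q"
      unfolding weight_def
      by (simp add: dim_over_eq_1_iff[OF subfield_set_subfld] card_subfld_q del: One_nat_def)
    also have "card ?V = card ?W"
      unfolding V by (rule card_image) (simp add: inj_on_def)
    also have "card ?W = q \<longleftrightarrow> ?W = (\<lambda>c. c * x) ` subfld q"
    proof -
      have sub: "(\<lambda>c. c * x) ` subfld q \<subseteq> ?W"
        by (auto simp: f_scale)
      have card: "card ((\<lambda>c. c * x) ` subfld q) = q"
        using x by (subst card_image) (auto simp: inj_on_def card_subfld_q)
      then show ?thesis
        using card_subset_eq[OF _ sub] by auto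
    qed
    also have "\<dots> \<longleftrightarrow> ?W \<subseteq> (\<lambda>c. c * x) ` subfld q"
      by (auto simp: f_scale)
    also have "\<dots> \<longleftrightarrow> (\<forall>y. y * f x = x * f y \<longrightarrow> y / x \<in> subfld q)"
    proof -
      have "y \<in> (\<lambda>c. c * x) ` subfld q \<longleftrightarrow> y / x \<in> subfld q" for y
        using x by (auto simp: image_iff intro!: bexI[of _ "y / x"])
      then show ?thesis
        by blast
    qed
    finally show ?thesis .
  qed
  have "scattered q (U_f3 q \<alpha>) \<longleftrightarrow>
      (\<forall>x. x \<noteq> 0 \<longrightarrow> weight q (U_f3 q \<alpha>) (proj_point (x, f x)) = 1)"
    unfolding scattered_def lin by blast
  also have "\<dots> \<longleftrightarrow> (\<forall>x. x \<noteq> 0 \<longrightarrow> (\<forall>y. y * f x = x * f y \<longrightarrow> y / x \<in> subfld q))"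
    using weight by blast
  finally show ?thesis
    by (simp add: f_def mem_subfld_q_iff del: One_nat_def)
qed

lemma not_scattered_imp_conjugate_roots:
  assumes N: "N = \<alpha> * frob 3 \<alpha>" "N \<noteq> 1" and A: "A = - N / (1 - N)"
    and x: "x \<noteq> 0" and eq: "y * (frob 5 x + \<alpha> * frob 2 x) = x * (frob 5 y + \<alpha> * frob 2 y)"
    and l1: "frob 1 (y / x) \<noteq> y / x"
  shows "\<exists>Y. Y + frob 1 Y = A + frob 1 A + frob 2 A - 1 \<and> Y * frob 1 Y = A * frob 1 A * frob 2 A"
proof -
  define l where "l = y / x"
  have y: "y = l * x"
    using x by (simp add: l_def)
  have "x * (frob 5 x * (frob 5 l - l)) = x * (- \<alpha> * frob 2 x * (frob 2 l - l))"
    using eq by (simp add: y frob_mult algebra_simps)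
  then have 1: "frob 5 x * (frob 5 l - l) = - \<alpha> * frob 2 x * (frob 2 l - l)"
    using x by (simp only: mult_cancel_left simp_thms)
  \<comment> \<open>The third Frobenius power exchanges x_2 and x_5, so multiplying the two
    relations lets x cancel.\<close>
  have 2: "frob 2 x * (frob 2 l - frob 3 l) = - frob 3 \<alpha> * frob 5 x * (frob 5 l - frob 3 l)"
    using arg_cong[OF 1, of "frob 3"] by (simp add: frob_simps)
  have "(frob 5 x * (frob 5 l - l)) * (frob 2 x * (frob 2 l - frob 3 l))
      = (- \<alpha> * frob 2 x * (frob 2 l - l)) * (- frob 3 \<alpha> * frob 5 x * (frob 5 l - frob 3 l))"
    by (simp only: 1 2)
  then have "(frob 2 x * frob 5 x) * ((frob 5 l - l) * (frob 2 l - frob 3 l))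
      = (frob 2 x * frob 5 x) * (N * ((frob 2 l - l) * (frob 5 l - frob 3 l)))"
    by (simp only: N mult_ac minus_mult_minus mult_minus_left mult_minus_right minus_minus)
  then have cr: "N * ((frob 2 l - l) * (frob 5 l - frob 3 l)) = (frob 5 l - l) * (frob 2 l - frob 3 l)"
    using x by (simp only: mult_cancel_left mult_eq_0_iff frob_eq_0_iff simp_thms)
  have l3: "frob 3 l \<noteq> l"
  proof
    assume l3: "frob 3 l = l"
    then have l5: "frob 5 l = frob 2 l"
      using frob_fr[of 2 3 l] by simp
    have "(N - 1) * (frob 2 l - l) ^ 2 = 0"
      using cr by (simp add: l3 l5 algebra_simps power2_eq_square)
    then have "frob 2 l = l"
      using N(2) by simp
    then have "frob 3 l = frob 1 l"
      using frob_fr[of 1 2 l] by simp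
    with l3 l1 show False
      by (simp add: l_def)
  qed
  have l4: "frob 4 l \<noteq> frob 1 l" and l5: "frob 5 l \<noteq> frob 2 l"
    using l3 frob_inj[of 1 "frob 3 l" l] frob_inj[of 2 "frob 3 l" l] by (auto simp: frob_fr)
  have A0: "A = - ((l - frob 5 l) * (frob 3 l - frob 2 l)) / ((frob 3 l - l) * (frob 5 l - frob 2 l))"
  proof -
    define p r where "p = (frob 2 l - l) * (frob 5 l - frob 3 l)" "r = (frob 5 l - l) * (frob 2 l - frob 3 l)"
    \<comment> \<open>The three-term relation between products of differences of four elements; it
      turns - N / (1 - N) with N p = r into a cross-ratio.\<close>
    have pr: "p - r = (frob 3 l - l) * (frob 5 l - frob 2 l)" "r = (l - frob 5 l) * (frob 3 l - frob 2 l)"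
      by (simp_all add: p_r_def algebra_simps)
    have "p - r \<noteq> 0"
      unfolding pr(1) using l3 l5 by simp
    moreover have "N * p = r"
      using cr by (simp add: p_r_def)
    ultimately have "A = - r / (p - r)"
      unfolding A using N(2) by (simp add: frac_eq_eq algebra_simps)
    then show ?thesis
      unfolding pr(1) unfolding pr(2) .
  qed
  have A1: "frob 1 A = (frob 1 l - l) * (frob 4 l - frob 3 l) / ((frob 3 l - l) * (frob 4 l - frob 1 l))"
    unfolding A0 using l3 l4 by (simp add: frob_simps divide_simps) (simp add: algebra_simps)
  have A2: "frob 2 A = (frob 2 l - frob 1 l) * (frob 5 l - frob 4 l) / ((frob 4 l - frob 1 l) * (frob 5 l - frob 2 l))"
    unfolding A0 using l5 l4 by (simp add: frob_simps divide_simps) (simp add: algebra_simps)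
  define Y where "Y = - ((frob 1 l - l) * (frob 3 l - frob 2 l) * (frob 5 l - frob 4 l))
      / ((frob 3 l - l) * (frob 4 l - frob 1 l) * (frob 5 l - frob 2 l))"
  have Y1: "frob 1 Y = (frob 2 l - frob 1 l) * (frob 4 l - frob 3 l) * (l - frob 5 l)
      / ((frob 3 l - l) * (frob 4 l - frob 1 l) * (frob 5 l - frob 2 l))"
  proof -
    have "frob 1 Y = - ((frob 2 l - frob 1 l) * (frob 4 l - frob 3 l) * (l - frob 5 l))
        / ((frob 4 l - frob 1 l) * (frob 5 l - frob 2 l) * - (frob 3 l - l))"
      by (simp add: Y_def frob_simps)
    then show ?thesis
      by (simp add: mult_ac del: minus_diff_eq)
  qed
  show ?thesis
    using cross_ratio_identities[OF l3 l4 l5 A0 A1 A2 Y_def Y1] by blast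
qed

lemma conjugate_roots_imp_not_scattered:
  assumes \<alpha>: "\<alpha> \<noteq> 0" and N: "N = \<alpha> * frob 3 \<alpha>" "N \<noteq> 1" and A: "A = - N / (1 - N)"
    and Y: "Y + frob 1 Y = A + frob 1 A + frob 2 A - 1" "Y * frob 1 Y = A * frob 1 A * frob 2 A"
  shows "\<not> scattered q (U_f3 q \<alpha>)"
proof -
  \<comment> \<open>The equation for \<open>\<phi>\<close> comes from raising to the q-th power, so
    everything is shifted by one Frobenius; trace and norm of A do not change.\<close>
  define a where "a = frob 1 \<alpha>"
  define A' where "A' = frob 1 A"
  have N1: "frob 1 N = a * frob 3 a" "frob 1 N \<noteq> 1"
    using N(2) frob_inj[of 1 N 1] by (auto simp: N(1) a_def frob_simps)
  have "A' = - frob 1 N / (1 - frob 1 N)"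
    by (simp add: A'_def A frob_simps)
  also have "\<dots> = frob 1 N / (frob 1 N - 1)"
    using minus_divide_divide[of "frob 1 N" "frob 1 N - 1"] by (simp only: minus_diff_eq)
  finally have "A' = frob 1 N / (frob 1 N - 1)" .
  moreover have "frob 3 A = A"
    by (simp add: A N frob_simps mult.commute)
  then have "Y + frob 1 Y = A' + frob 1 A' + frob 2 A' - 1" "Y * frob 1 Y = A' * frob 1 A' * frob 2 A'"
    unfolding Y by (simp_all add: A'_def frob_simps mult_ac)
  moreover have "a \<noteq> 0"
    using \<alpha> by (simp add: a_def)
  ultimately obtain b where
    "frob 4 b * frob 5 b * (frob 1 a * b + a * frob 3 b) = (1 - frob 1 N) * (1 - frob 1 (frob 1 N))"
    "frob 1 b * frob 5 b * (b + a * frob 4 a * frob 3 b) = - frob 5 a * (1 - frob 1 N) * (1 - frob 1 (frob 1 N))"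
    using scaling_exists[OF _ N1] by blast
  then obtain u v where uv: "u \<noteq> 0" "frob 3 (v / u) \<noteq> v / u"
    "frob 5 u + \<alpha> * frob 2 u = - frob 5 b * u" "frob 5 v + \<alpha> * frob 2 v = - frob 5 b * v"
    using fixed_points_exist[OF \<alpha> a_def N1] by blast
  then have "v * (frob 5 u + \<alpha> * frob 2 u) = u * (frob 5 v + \<alpha> * frob 2 v)"
    by simp
  moreover have "frob 1 (v / u) \<noteq> v / u"
    using uv(2) frob_fixed by blast
  ultimately show ?thesis
    unfolding scattered_U_f3_iff using uv(1) by blast
qed

theorem scattered_iff_two_roots:
  fixes \<alpha> A :: 'a
  assumes "rel_norm (q ^ 3) 2 \<alpha> \<noteq> 0" "rel_norm (q ^ 3) 2 \<alpha> \<noteq> 1"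
    and A: "A = - (\<alpha> ^ (q ^ 3 + 1)) / (1 - \<alpha> ^ (q ^ 3 + 1))"
  shows "scattered q (U_f3 q \<alpha>) \<longleftrightarrow>
    (\<exists>y\<^sub>1\<in>subfld q. \<exists>y\<^sub>2\<in>subfld q. y\<^sub>1 \<noteq> y\<^sub>2 \<and>
      (\<forall>Y\<in>{y\<^sub>1, y\<^sub>2}. Y ^ 2 - (rel_trace q 3 A - 1) * Y + rel_norm q 3 A = 0))"
proof -
  define N where "N = \<alpha> * frob 3 \<alpha>"
  have pow: "\<alpha> ^ (q ^ 3 + 1) = N"
    by (simp add: N_def frob_def)
  have N: "N \<noteq> 0" "N \<noteq> 1"
    using assms(1,2) unfolding rel_norm_2 pow by simp_all
  have A: "A = - N / (1 - N)"
    using A unfolding pow .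
  have A3: "frob 3 A = A"
    by (simp add: A N_def frob_simps mult.commute)
  let ?t = "A + frob 1 A + frob 2 A - 1" and ?m = "A * frob 1 A * frob 2 A"
  have "frob 1 ?t = ?t" "frob 1 ?m = ?m"
    using A3 by (simp_all add: frob_simps mult_ac)
  note roots = conjugate_roots_iff[OF this]
  have "\<not> scattered q (U_f3 q \<alpha>) \<longleftrightarrow> (\<exists>Y. Y + frob 1 Y = ?t \<and> Y * frob 1 Y = ?m)"
  proof
    assume "\<not> scattered q (U_f3 q \<alpha>)"
    then show "\<exists>Y. Y + frob 1 Y = ?t \<and> Y * frob 1 Y = ?m"
      unfolding scattered_U_f3_iff using not_scattered_imp_conjugate_roots[OF N_def N(2) A] by blast
  next
    assume "\<exists>Y. Y + frob 1 Y = ?t \<and> Y * frob 1 Y = ?m"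
    moreover have "\<alpha> \<noteq> 0"
      using N(1) by (auto simp: N_def)
    ultimately show "\<not> scattered q (U_f3 q \<alpha>)"
      using conjugate_roots_imp_not_scattered[OF _ N_def N(2) A] by blast
  qed
  then show ?thesis
    unfolding roots rel_trace_3 rel_norm_3 by blast
qed

end

subsection \<open>Existence of scattered members of the family\<close>

text \<open>As w and 1 - w have sum 1 and product A, their cubes have sum 1 - 3 A and product
  A^3.\<close>

lemma minus_cubes_roots:
  fixes w :: "'a::comm_ring_1"
  assumes "A = w * (1 - w)" "y = - (w ^ 3) \<or> y = - ((1 - w) ^ 3)"
  shows "y ^ 2 - (A + A + A - 1) * y + A * A * A = 0"
proof -
  have "y ^ 2 - (A + A + A - 1) * y + A * A * A = (y + w ^ 3) * (y + (1 - w) ^ 3)"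
    unfolding assms(1) by (simp add: algebra_simps power2_eq_square power3_eq_cube)
  with assms(2) show ?thesis
    by auto
qed

context
  fixes z :: "'a::field"
  assumes 2: "(2 :: 'a) = 0"
begin

lemma char_2_add_self: "x + x = (0 :: 'a)"
  using 2 by (simp flip: mult_2)

lemma char_2_minus: "- x = (x :: 'a)"
  using char_2_add_self[of x] by (simp only: neg_eq_iff_add_eq_0)

text \<open>Serves q = 4: the powers 4 and 8 give the conjugate z^q and membership in F_8, a
  subfield of F_{q^3}.\<close>

lemma char_2_cubic_powers:
  assumes z: "z ^ 3 = z + 1"
  shows "z ^ 4 = z ^ 2 + z" "z ^ 8 = z"
proof -
  have "z ^ 4 = z * z ^ 3"
    by (simp add: power4_eq_xxxx power3_eq_cube)
  then show z4: "z ^ 4 = z ^ 2 + z"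
    unfolding z by (simp add: algebra_simps power2_eq_square)
  have "z ^ 8 = (z ^ 4) ^ 2"
    by (simp flip: power_mult)
  also have "\<dots> = z ^ 4 + 2 * z ^ 3 + z ^ 2"
    by (subst z4) (simp add: algebra_simps power2_eq_square power3_eq_cube power4_eq_xxxx)
  also have "\<dots> = z + 2 * (z ^ 2 + z ^ 3)"
    unfolding z4 by (simp add: algebra_simps)
  finally show "z ^ 8 = z"
    using 2 by simp
qed

end

text \<open>Serves q = 3: cubing is additive, z^9 is the second conjugate, and z^27 = z places z in
  F_{q^3}.\<close>

lemma char_3_cubic_powers:
  fixes z :: "'a::field"
  assumes 3: "(3 :: 'a) = 0" and z: "z ^ 3 = z ^ 2 - 1"
  shows "z ^ 9 = - (z ^ 2) - z - 1" "z ^ 27 = z"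
proof -
  have cube: "(x + y) ^ 3 = x ^ 3 + y ^ 3" for x y :: 'a
  proof -
    have "(x + y) ^ 3 = x ^ 3 + y ^ 3 + 3 * (x ^ 2 * y + x * y ^ 2)"
      by (simp add: algebra_simps power2_eq_square power3_eq_cube)
    with 3 show ?thesis
      by simp
  qed
  have cube_neg: "(- x) ^ 3 = - (x ^ 3)" for x :: 'a
    by simp
  have z4: "z ^ 4 = z ^ 2 - 1 - z"
    using arg_cong[OF z, of "\<lambda>x. z * x"] z by (simp add: algebra_simps power2_eq_square power3_eq_cube power4_eq_xxxx)
  have "(z ^ 2) ^ 3 = (z ^ 3) ^ 2"
    by (simp flip: power_mult)
  also have "\<dots> = z ^ 4 - 2 * z ^ 2 + 1"
    unfolding z by (simp add: algebra_simps power2_eq_square power4_eq_xxxx)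
  finally have z6: "(z ^ 2) ^ 3 = - (z ^ 2) - z"
    unfolding z4 by simp
  have "z ^ 9 = (z ^ 3) ^ 3"
    by (simp flip: power_mult)
  also have "\<dots> = (z ^ 2) ^ 3 + (- 1) ^ 3"
    unfolding z by (metis cube diff_conv_add_uminus)
  finally show z9: "z ^ 9 = - (z ^ 2) - z - 1"
    unfolding z6 by simp
  have "z ^ 27 = (z ^ 9) ^ 3"
    by (simp flip: power_mult)
  also have "\<dots> = (- (z ^ 2)) ^ 3 + (- z) ^ 3 + (- 1) ^ 3"
    unfolding z9 by (metis cube diff_conv_add_uminus)
  also have "\<dots> = z"
    unfolding cube_neg z6 z by simp
  finally show "z ^ 27 = z" .
qed

context sextic_field
begin

lemma of_nat_prime_eq_0:
  assumes "Factorial_Ring.prime p" "q = p ^ k"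
  shows "of_nat p = (0 :: 'a)"
proof -
  obtain n where n: "n > 0" "q = CHAR('a) ^ n"
    using q_char_power by blast
  then have "CHAR('a) dvd p ^ k"
    using assms(2) by (metis dvd_power)
  then have "CHAR('a) = p"
    using prime_char assms(1) by (metis prime_dvd_power primes_dvd_imp_eq)
  then show ?thesis
    by (metis of_nat_CHAR)
qed

lemma frob_numeral [simp]: "frob i (numeral n) = numeral n"
proof -
  have "frob i (of_nat m) = of_nat m" for m
    by (induction m) (simp_all add: frob_add)
  from this[of "numeral n"] show ?thesis
    by simp
qed

text \<open>The scattered criterion in terms of A alone: A = 0 would give norm 0, and A = 1 is not
  of the form - N / (1 - N).\<close>

definition admissible :: "'a \<Rightarrow> bool" where
  "admissible A \<longleftrightarrow> A \<noteq> 0 \<and> A \<noteq> 1 \<and> frob 3 A = A \<and>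
    (\<exists>y\<^sub>1\<in>subfld q. \<exists>y\<^sub>2\<in>subfld q. y\<^sub>1 \<noteq> y\<^sub>2 \<and>
      (\<forall>Y\<in>{y\<^sub>1, y\<^sub>2}. Y ^ 2 - (rel_trace q 3 A - 1) * Y + rel_norm q 3 A = 0))"

text \<open>For \<open>A\<close> in the subfield of order \<open>q\<close> the quadratic has discriminant \<open>(1 - A)\<^sup>2 (1 - 4 A)\<close>;
  writing \<open>1 - 4 A = (1 - 2 w)\<^sup>2\<close> makes its roots rational, in every characteristic.\<close>
lemma admissible_of_parameter:
  assumes w: "frob 1 w = w" "w \<noteq> 0" "w \<noteq> 1" "2 * w \<noteq> 1" "w ^ 2 - w + 1 \<noteq> 0"
  shows "admissible (w * (1 - w))"
proof -
  define A where "A = w * (1 - w)"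
  have frA: "frob i A = A" for i
    using frob_fixed[OF w(1), of i] by (simp add: A_def frob_simps)
  have "A \<noteq> 0"
    using w by (simp add: A_def)
  moreover have "A \<noteq> 1"
    using w(5) by (auto simp: A_def algebra_simps power2_eq_square)
  moreover have "- (w ^ 3) \<in> subfld q" "- ((1 - w) ^ 3) \<in> subfld q"
    using w(1) by (simp_all add: mem_subfld_q_iff frob_simps power3_eq_cube del: One_nat_def)
  moreover have "- (w ^ 3) \<noteq> - ((1 - w) ^ 3)"
  proof
    assume "- (w ^ 3) = - ((1 - w) ^ 3)"
    moreover have "w ^ 3 - (1 - w) ^ 3 = (2 * w - 1) * (w ^ 2 - w + 1)"
      by (simp add: algebra_simps power2_eq_square power3_eq_cube)
    ultimately have "(2 * w - 1) * (w ^ 2 - w + 1) = 0"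
      by simp
    with w(4,5) show False
      by simp
  qed
  moreover have "\<forall>Y\<in>{- (w ^ 3), - ((1 - w) ^ 3)}.
      Y ^ 2 - (rel_trace q 3 A - 1) * Y + rel_norm q 3 A = 0"
    unfolding rel_trace_3 rel_norm_3 frA using minus_cubes_roots[OF A_def] by blast
  ultimately show ?thesis
    unfolding admissible_def A_def[symmetric] using frA by blast
qed

lemma admissible_exists_large:
  assumes "q > 5"
  shows "\<exists>A. admissible A"
proof -
  let ?p = "[:1, - 1, 1:] :: 'a poly"
  \<comment> \<open>At most five values of w are excluded, hence q > 5. In characteristic 2 the
    entry \<open>1 / 2\<close> is 0 and the condition 2 w = 1 cannot occur.\<close>
  let ?X = "{0, 1, 1 / 2} \<union> {w::'a. poly ?p w = 0}"
  have "card ?X \<le> card {0, 1, 1 / 2 :: 'a} + card {w. poly ?p w = 0}"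
    by (rule card_Un_le)
  also have "card {0, 1, 1 / 2 :: 'a} \<le> 3"
    by (simp add: card_insert_if)
  also have "card {w. poly ?p w = 0} \<le> 2"
    using card_poly_roots_bound[of ?p] by simp
  finally have "card ?X < card (subfld q :: 'a set)"
    using assms by (simp add: card_subfld_q)
  then have "\<not> subfld q \<subseteq> ?X"
    using card_mono[of ?X "subfld q"] by (meson finite leD)
  then obtain w where w: "w \<in> subfld q" "w \<noteq> 0" "w \<noteq> 1" "w \<noteq> 1 / 2" "poly ?p w \<noteq> 0"
    by blast
  have "2 * w \<noteq> 1"
  proof
    assume "2 * w = 1"
    moreover from this have "(2 :: 'a) \<noteq> 0"
      by auto
    ultimately show False
      using w(4) by (simp add: field_simps)
  qed
  moreover have "w ^ 2 - w + 1 \<noteq> 0"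
    using w(5) by (simp add: algebra_simps power2_eq_square)
  ultimately show ?thesis
    using admissible_of_parameter[of w] w by (auto simp: mem_subfld_q_iff)
qed

text \<open>In F_5 the element 1/2 is 3 and w^2 - w + 1 has no root, so w = 2 is allowed.\<close>

lemma admissible_exists_5:
  assumes "q = 5"
  shows "\<exists>A. admissible A"
proof -
  have 5: "(5 :: 'a) = 0"
    using of_nat_prime_eq_0[of 5 1] assms by simp
  have 3: "(3 :: 'a) \<noteq> 0"
  proof
    assume "(3 :: 'a) = 0"
    moreover have "(1 :: 'a) = 2 * 3 - 5"
      by simp
    ultimately show False
      using 5 by simp
  qed
  have 2: "(2 :: 'a) \<noteq> 0"
  proof
    assume "(2 :: 'a) = 0"
    moreover have "(1 :: 'a) = 5 - 2 * 2"
      by simp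
    ultimately show False
      using 5 by simp
  qed
  have 4: "2 * 2 \<noteq> (1 :: 'a)"
  proof
    assume "2 * 2 = (1 :: 'a)"
    moreover have "(3 :: 'a) = 2 * 2 - 1"
      by simp
    ultimately show False
      using 3 by simp
  qed
  have "(2 :: 'a) \<noteq> 1"
  proof
    assume "(2 :: 'a) = 1"
    moreover have "(1 :: 'a) = 2 - 1"
      by simp
    ultimately show False
      by simp
  qed
  moreover have "(2 :: 'a) ^ 2 - 2 + 1 = 3"
    by simp
  ultimately show ?thesis
    using admissible_of_parameter[of 2] 2 3 4 by (metis frob_numeral)
qed

text \<open>Every w in F_4 other than 0 and 1 is a root of w^2 - w + 1. A root A of X^3 + X + 1 has
  trace 0 and norm 1, leaving Y^2 + Y + 1, which splits over F_4.\<close>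

lemma admissible_exists_4:
  assumes q: "q = 4"
  shows "\<exists>A. admissible A"
proof -
  have 2: "(2 :: 'a) = 0"
    using of_nat_prime_eq_0[of 2 2] q by simp
  have ac2: "(2 :: 'a alg_closure) = 0"
    using arg_cong[OF 2, of to_ac] by simp
  have "\<exists>A::'a. poly [:1, 1, 0, 1:] A = 0"
  proof (rule poly_root_in_field)
    fix z :: "'a alg_closure" assume "poly (map_poly to_ac [:1, 1, 0, 1:]) z = 0"
    then have "z ^ 3 = - (z + 1)"
      by (simp add: map_poly_pCons power3_eq_cube algebra_simps eq_neg_iff_add_eq_0)
    then have "z ^ 3 = z + 1"
      unfolding char_2_minus[OF ac2] .
    then have "z ^ (8 ^ 4) = z"
      by (intro power_iterate_fixed char_2_cubic_powers(2) ac2)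
    then show "z ^ CARD('a) = z"
      by (simp add: card_field q)
  qed simp
  then obtain A :: 'a where "poly [:1, 1, 0, 1:] A = 0"
    by blast
  then have "A ^ 3 = - (A + 1)"
    by (simp add: power3_eq_cube algebra_simps eq_neg_iff_add_eq_0)
  then have A3: "A ^ 3 = A + 1"
    unfolding char_2_minus[OF 2] .
  note A4 = char_2_cubic_powers(1)[OF 2 A3] and A8 = char_2_cubic_powers(2)[OF 2 A3]
  have frob: "frob 1 A = A ^ 2 + A" "frob 2 A = A ^ 2" "frob 3 A = A"
  proof -
    show "frob 1 A = A ^ 2 + A"
      unfolding frob_def unfolding q by (simp add: A4)
    have "frob 2 A = (A ^ 8) ^ 2"
      unfolding frob_def unfolding q by (simp flip: power_mult)
    then show "frob 2 A = A ^ 2"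
      by (simp add: A8)
    have "frob 3 A = (A ^ 8) ^ 8"
      unfolding frob_def unfolding q by (simp flip: power_mult)
    then show "frob 3 A = A"
      by (simp add: A8)
  qed
  have trace: "rel_trace q 3 A = 0"
    unfolding rel_trace_3 frob using char_2_add_self[OF 2, of "A ^ 2 + A"] by (simp add: algebra_simps)
  have "rel_norm q 3 A = A ^ 2 * A ^ 3 + A ^ 4"
    unfolding rel_norm_3 frob by (simp add: algebra_simps power2_eq_square power3_eq_cube power4_eq_xxxx)
  also have "A ^ 2 * A ^ 3 = A ^ 2 * (A + 1)"
    by (simp only: A3)
  also have "\<dots> + A ^ 4 = A ^ 3 + A ^ 2 + (A ^ 2 + A)"
    unfolding A4 by (simp add: algebra_simps power2_eq_square power3_eq_cube)
  also have "\<dots> = 1 + 2 * (A ^ 2 + A)"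
    unfolding A3 by (simp add: algebra_simps)
  finally have norm: "rel_norm q 3 A = 1"
    using 2 by simp
  obtain w :: 'a where w: "w ^ 2 - w + 1 = 0"
    using quadratic_root_exists[of 1 1] by auto
  then have "w ^ 2 = - (- w + 1)"
    by (simp add: algebra_simps)
  then have w2: "w ^ 2 = w + 1"
    unfolding char_2_minus[OF 2] .
  have "w ^ 4 = (w ^ 2) ^ 2"
    by (simp flip: power_mult)
  also have "\<dots> = w + 2 * (w + 1)"
    unfolding w2 using w2 by (simp add: algebra_simps power2_eq_square)
  finally have "frob 1 w = w"
    unfolding frob_def unfolding q using 2 by simp
  then have "w \<in> subfld q" "w + 1 \<in> subfld q"
    by (simp_all add: mem_subfld_q_iff frob_add del: One_nat_def)
  moreover have "(w + 1) ^ 2 + (w + 1) + 1 = (w ^ 2 + w + 1) + 2 * (w + 1)"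
    by (simp add: algebra_simps power2_eq_square)
  then have "Y ^ 2 - (rel_trace q 3 A - 1) * Y + rel_norm q 3 A = 0" if "Y \<in> {w, w + 1}" for Y
    using that w2 2 char_2_add_self[OF 2, of "w + 1"] by (auto simp: trace norm add.assoc)
  moreover have "A \<noteq> 0"
    using A3 by auto
  moreover have "A \<noteq> 1"
    using A3 2 by auto
  ultimately have "admissible A"
    unfolding admissible_def using frob(3) by (metis add_cancel_right_right zero_neq_one)
  then show ?thesis ..
qed

text \<open>The only w in F_3 besides 0 and 1 is 2 = 1/2. A root A of X^3 - X^2 + 1 has trace 1 and
  norm -1, leaving Y^2 - 1.\<close>

lemma admissible_exists_3:
  assumes q: "q = 3"
  shows "\<exists>A. admissible A"
proof -
  have 3: "(3 :: 'a) = 0"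
    using of_nat_prime_eq_0[of 3 1] q by simp
  have ac3: "(3 :: 'a alg_closure) = 0"
    using arg_cong[OF 3, of to_ac] by simp
  have "\<exists>A::'a. poly [:1, 0, - 1, 1:] A = 0"
  proof (rule poly_root_in_field)
    fix z :: "'a alg_closure" assume "poly (map_poly to_ac [:1, 0, - 1, 1:]) z = 0"
    then have "z ^ 3 = z ^ 2 - 1"
      by (simp add: map_poly_pCons power3_eq_cube power2_eq_square algebra_simps eq_neg_iff_add_eq_0)
    then have "z ^ (27 ^ 2) = z"
      by (intro power_iterate_fixed char_3_cubic_powers(2) ac3)
    then show "z ^ CARD('a) = z"
      by (simp add: card_field q)
  qed simp
  then obtain A :: 'a where "poly [:1, 0, - 1, 1:] A = 0"
    by blast
  then have A3: "A ^ 3 = A ^ 2 - 1"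
    by (simp add: power3_eq_cube power2_eq_square algebra_simps eq_neg_iff_add_eq_0)
  have frob: "frob 1 A = A ^ 2 - 1" "frob 2 A = - (A ^ 2) - A - 1" "frob 3 A = A"
    unfolding frob_def unfolding q using A3 char_3_cubic_powers[OF 3 A3] by simp_all
  have "rel_trace q 3 A = 1 - 3"
    unfolding rel_trace_3 frob by (simp add: algebra_simps)
  then have trace: "rel_trace q 3 A = 1"
    using 3 by simp
  have "rel_norm q 3 A = - ((A ^ 3 - A) * (A ^ 2 + A + 1))"
    unfolding rel_norm_3 frob by (simp add: algebra_simps power2_eq_square power3_eq_cube)
  also have "(A ^ 3 - A) * (A ^ 2 + A + 1) = (A ^ 2 - 1 - A) * (A ^ 2 + A + 1)"
    by (simp only: A3)
  also have "\<dots> = A * A ^ 3 - (A + 1) ^ 2"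
    by (simp add: algebra_simps power2_eq_square power3_eq_cube)
  also have "A * A ^ 3 = A * (A ^ 2 - 1)"
    by (simp only: A3)
  also have "\<dots> = A ^ 3 - A"
    by (simp add: algebra_simps power2_eq_square power3_eq_cube)
  also have "- (A ^ 3 - A - (A + 1) ^ 2) = 3 * (A + 1) - 1"
    unfolding A3 by (simp add: algebra_simps power2_eq_square)
  finally have norm: "rel_norm q 3 A = - 1"
    using 3 by simp
  have "(1 :: 'a) \<noteq> - 1"
  proof
    assume "(1 :: 'a) = - 1"
    then have "(2 :: 'a) = 0"
      by (simp add: eq_neg_iff_add_eq_0)
    moreover have "(1 :: 'a) = 3 - 2"
      by simp
    ultimately show False
      using 3 by simp
  qed
  moreover have "(1 :: 'a) \<in> subfld q" "(- 1 :: 'a) \<in> subfld q"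
    by (simp_all add: mem_subfld_q_iff frob_minus)
  moreover have "\<forall>Y\<in>{1, - 1}. Y ^ 2 - (rel_trace q 3 A - 1) * Y + rel_norm q 3 A = 0"
    by (simp add: trace norm)
  moreover have "A \<noteq> 0" "A \<noteq> 1"
    using A3 by auto
  ultimately have "admissible A"
    unfolding admissible_def using frob(3) by blast
  then show ?thesis ..
qed

text \<open>For q = 2 distinct roots would be 0 and 1, forcing norm 0 and thus A = 0.\<close>

lemma admissible_exists:
  assumes "q > 2"
  shows "\<exists>A. admissible A"
proof -
  from assms consider "q = 3" | "q = 4" | "q = 5" | "q > 5"
    by linarith
  then show ?thesis
    using admissible_exists_3 admissible_exists_4 admissible_exists_5 admissible_exists_large by cases auto
qed

lemma scattered_exists:
  assumes "q > 2"
  shows "\<exists>\<alpha>::'a. rel_norm (q ^ 3) 2 \<alpha> \<noteq> 0 \<and> rel_norm (q ^ 3) 2 \<alpha> \<noteq> 1 \<and> scattered q (U_f3 q \<alpha>)"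
proof -
  obtain A where A: "admissible A"
    using admissible_exists[OF assms] by blast
  \<comment> \<open>The map N -> - N / (1 - N) is its own inverse, so this N returns the chosen
    A.\<close>
  define N where "N = A / (A - 1)"
  have A01: "A \<noteq> 0" "A \<noteq> 1" "frob 3 A = A"
    using A by (simp_all add: admissible_def)
  have N: "N \<noteq> 0" "N \<noteq> 1" "frob 3 N = N"
    using A01 by (simp_all add: N_def frob_simps divide_eq_1_iff)
  obtain \<alpha> where "\<alpha> * frob 3 \<alpha> = N"
    using norm_2_surj[OF N(1,3)] by blast
  then have pow: "\<alpha> ^ (q ^ 3 + 1) = N"
    by (simp add: frob_def)
  have norm: "rel_norm (q ^ 3) 2 \<alpha> \<noteq> 0" "rel_norm (q ^ 3) 2 \<alpha> \<noteq> 1"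
    unfolding rel_norm_2 pow using N by simp_all
  have "A = - N / (1 - N)"
    using A01 by (simp add: N_def divide_simps)
  then have "scattered q (U_f3 q \<alpha>)"
    using scattered_iff_two_roots[OF norm, of A] A unfolding pow admissible_def by blast
  with norm show ?thesis
    by blast
qed

end

theorem theorem7p3:
  fixes q :: nat
  assumes q: "primepow q"
    and card: "CARD('a::{field,finite}) = q ^ 6"
  shows "(\<forall>\<alpha>::'a. rel_norm (q ^ 3) 2 \<alpha> \<noteq> 0 \<and> rel_norm (q ^ 3) 2 \<alpha> \<noteq> 1 \<longrightarrow>
            (let A = - (\<alpha> ^ (q ^ 3 + 1)) / (1 - \<alpha> ^ (q ^ 3 + 1)) in
             scattered q (U_f3 q \<alpha>) \<longleftrightarrow>
             (\<exists>y\<^sub>1 \<in> subfld q. \<exists>y\<^sub>2 \<in> subfld q. y\<^sub>1 \<noteq> y\<^sub>2 \<and>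
                (\<forall>Y \<in> {y\<^sub>1, y\<^sub>2}. Y ^ 2 - (rel_trace q 3 A - 1) * Y + rel_norm q 3 A = 0)))) \<and>
         (q > 2 \<longrightarrow>
            (\<exists>\<alpha>::'a. rel_norm (q ^ 3) 2 \<alpha> \<noteq> 0 \<and> rel_norm (q ^ 3) 2 \<alpha> \<noteq> 1 \<and>
                    scattered q (U_f3 q \<alpha>)))"
proof -
  interpret sextic_field q "TYPE('a)"
    using q card by unfold_locales
  show ?thesis
    unfolding Let_def using scattered_iff_two_roots scattered_exists by blast
qed

end
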